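(* Let $X$ be a saturated directed space whose underlying space $|X|$ is Hausdorff and such that every quasicompact subspace of $|X|$ is metrizable. Then for all $u,v\in|X|$ the quotient map $q_{u,v}:\overrightarrow{\mathcal P}(X)(u,v)\to\overrightarrow{\mathcal T}(X)(u,v)$ from directed paths with fixed endpoints to traces is a trivial q-fibration of spaces, and the trace space $\overrightarrow{\mathcal T}(X)(u,v)$ is $\Delta$-Hausdorff.
   Context: $\mathbb I=[0,1]$. $\mathbf{Top}$ denotes one of the following two categories (the statement is asserted for each choice): the category of $\Delta$-generated spaces (spaces whose topology is final with respect to all continuous maps from standard topological simplices), or its full subcategory of $\Delta$-Hausdorff spaces ($Y$ is $\Delta$-Hausdorff if the image of every continuous map $\mathbb I\to Y$ is closed). For a topological space $Y$, $k_\Delta Y$ is the same set with the final topology with respect to all continuous maps from standard topological simplices to $Y$. Quasicompact means every open cover has a finite subcover (no separation assumption). A directed space $X=(|X|,dX)$ consists of a space $|X|\in\mathbf{Top}$ and a set $dX$ of continuous maps $\mathbb I\to|X|$ (directed paths) containing all constant paths and closed under precomposition with continuous nondecreasing maps $\mathbb I\to\mathbb I$ and under normalized composition $(x*_Ny)(t)=x(2t)$ for $t\le\frac12$, $y(2t-1)$ for $t\ge\frac12$, when $x(1)=y(0)$. $\mathsf{Rep}_+$ is the monoid of continuous nondecreasing surjections $\mathbb I\to\mathbb I$. $X$ is saturated if for every continuous $x:\mathbb I\to|X|$ and $\phi\in\mathsf{Rep}_+$, $x\circ\phi\in dX$ implies $x\in dX$. For $u,v\in|X|$, $\overrightarrow{\mathcal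 P}(X)(u,v)=k_\Delta\{x\in dX\mid x(0)=u,\ x(1)=v\}$, where the set carries the relative compact-open topology. Trace equivalence is the equivalence relation generated by $x\sim x\circ\phi$, $\phi\in\mathsf{Rep}_+$. The trace space $\overrightarrow{\mathcal T}(X)(u,v)$ is the set of trace equivalence classes with the quotient topology of $\overrightarrow{\mathcal P}(X)(u,v)$, and $q_{u,v}$ is the quotient map. A trivial q-fibration is a map with the right lifting property with respect to the inclusions $\mathsf S^{n-1}\subset\mathsf D^n$ for all $n\ge0$ ($\mathsf S^{-1}=\varnothing$, $\mathsf D^0$ a point), equivalently a Serre fibration that is a weak homotopy equivalence. *)

theory Defs
  imports "HOL-Analysis.Analysis" "HOL-Homology.Homology"
begin

section \<open>Delta-generated and Delta-Hausdorff spaces\<close>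

definition k_Delta :: "'a topology \<Rightarrow> 'a topology" where
  "k_Delta Y = topology (\<lambda>U. U \<subseteq> topspace Y \<and>
     (\<forall>p f. continuous_map (subtopology (powertop_real UNIV) (standard_simplex p)) Y f \<longrightarrow>
        openin (subtopology (powertop_real UNIV) (standard_simplex p))
               {x \<in> standard_simplex p. f x \<in> U}))"

lemma openin_k_Delta:
  "openin (k_Delta Y) U \<longleftrightarrow> U \<subseteq> topspace Y \<and>
     (\<forall>p f. continuous_map (subtopology (powertop_real UNIV) (standard_simplex p)) Y f \<longrightarrow>
        openin (subtopology (powertop_real UNIV) (standard_simplex p))
               {x \<in> standard_simplex p. f x \<in> U})"
proof -
  have "istopology (\<lambda>U. U \<subseteq> topspace Y \<and>
     (\<forall>p f. continuous_map (subtopology (powertop_real UNIV) (standard_simplex p)) Y f \<longrightarrow>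
        openin (subtopology (powertop_real UNIV) (standard_simplex p))
               {x \<in> standard_simplex p. f x \<in> U}))" (is "istopology ?P")
    unfolding istopology_def
  proof (intro conjI allI impI)
    fix S T assume S: "?P S" and T: "?P T"
    then show "S \<inter> T \<subseteq> topspace Y" by blast
    fix p f
    assume f: "continuous_map (subtopology (powertop_real UNIV) (standard_simplex p)) Y f"
    have "{x \<in> standard_simplex p. f x \<in> S \<inter> T}
        = {x \<in> standard_simplex p. f x \<in> S} \<inter> {x \<in> standard_simplex p. f x \<in> T}" by blast
    then show "openin (subtopology (powertop_real UNIV) (standard_simplex p))
                 {x \<in> standard_simplex p. f x \<in> S \<inter> T}"
      using S T f by (simp add: openin_Int)
  next
    fix \<K> assume K: "\<forall>S\<in>\<K>. ?P S"
    then show "\<Union> \<K> \<subseteq> topspace Y" by blast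
    fix p f
    assume f: "continuous_map (subtopology (powertop_real UNIV) (standard_simplex p)) Y f"
    have "{x \<in> standard_simplex p. f x \<in> \<Union> \<K>}
        = (\<Union>S\<in>\<K>. {x \<in> standard_simplex p. f x \<in> S})" by blast
    moreover have "openin (subtopology (powertop_real UNIV) (standard_simplex p))
                 (\<Union>S\<in>\<K>. {x \<in> standard_simplex p. f x \<in> S})"
      using K f by (intro openin_Union) blast
    ultimately show "openin (subtopology (powertop_real UNIV) (standard_simplex p))
                 {x \<in> standard_simplex p. f x \<in> \<Union> \<K>}" by simp
  qed
  then show ?thesis by (simp add: k_Delta_def)
qed

lemma topspace_k_Delta [simp]: "topspace (k_Delta Y) = topspace Y"
proof
  show "topspace (k_Delta Y) \<subseteq> topspace Y"
    using openin_k_Delta [of Y "topspace (k_Delta Y)"] by simp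
  have "openin (k_Delta Y) (topspace Y)"
    unfolding openin_k_Delta
  proof (intro conjI allI impI subset_refl)
    fix p f
    assume "continuous_map (subtopology (powertop_real UNIV) (standard_simplex p)) Y f"
    from openin_continuous_map_preimage [OF this openin_topspace]
    show "openin (subtopology (powertop_real UNIV) (standard_simplex p))
            {x \<in> standard_simplex p. f x \<in> topspace Y}"
      by simp
  qed
  then show "topspace Y \<subseteq> topspace (k_Delta Y)" by (rule openin_subset)
qed

definition Delta_generated :: "'a topology \<Rightarrow> bool" where
  "Delta_generated Y \<longleftrightarrow> k_Delta Y = Y"

definition Delta_Hausdorff :: "'a topology \<Rightarrow> bool" where
  "Delta_Hausdorff Y \<longleftrightarrow> (\<forall>f. pathin Y f \<longrightarrow> closedin Y (f ` {0..1}))"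

text \<open>The two admissible choices for the category of spaces.\<close>

datatype Top_choice = All_Delta_generated | Only_Delta_Hausdorff

fun in_Top :: "Top_choice \<Rightarrow> 'a topology \<Rightarrow> bool" where
  "in_Top All_Delta_generated Y \<longleftrightarrow> Delta_generated Y"
| "in_Top Only_Delta_Hausdorff Y \<longleftrightarrow> Delta_generated Y \<and> Delta_Hausdorff Y"

section \<open>Directed spaces\<close>

text \<open>Maps out of the unit interval are represented by functions on the reals that are
  extensional on \<open>{0..1}\<close>, so that equality of paths is equality of functions.\<close>

definition paths :: "'a topology \<Rightarrow> (real \<Rightarrow> 'a) set" where
  "paths Y = {x. pathin Y x \<and> x \<in> extensional {0..1}}"

definition reparam :: "(real \<Rightarrow> 'a) \<Rightarrow> (real \<Rightarrow> real) \<Rightarrow> real \<Rightarrow> 'a" where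
  "reparam x \<phi> = (\<lambda>t\<in>{0..1}. x (\<phi> t))"

definition norm_comp :: "(real \<Rightarrow> 'a) \<Rightarrow> (real \<Rightarrow> 'a) \<Rightarrow> real \<Rightarrow> 'a" where
  "norm_comp x y = (\<lambda>t\<in>{0..1}. if t \<le> 1/2 then x (2 * t) else y (2 * t - 1))"

definition Mon :: "(real \<Rightarrow> real) set" where
  "Mon = {\<phi>. continuous_on {0..1} \<phi> \<and> mono_on {0..1} \<phi> \<and> \<phi> ` {0..1} \<subseteq> {0..1}}"

definition Rep :: "(real \<Rightarrow> real) set" where
  "Rep = {\<phi>. continuous_on {0..1} \<phi> \<and> mono_on {0..1} \<phi> \<and> \<phi> ` {0..1} = {0..1}}"

record 'a dspace =
  underlying :: "'a topology"
  dpaths :: "(real \<Rightarrow> 'a) set"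

definition directed_space :: "Top_choice \<Rightarrow> 'a dspace \<Rightarrow> bool" where
  "directed_space C X \<longleftrightarrow>
     in_Top C (underlying X) \<and>
     dpaths X \<subseteq> paths (underlying X) \<and>
     (\<forall>a \<in> topspace (underlying X). (\<lambda>t\<in>{0..1}. a) \<in> dpaths X) \<and>
     (\<forall>x \<in> dpaths X. \<forall>\<phi> \<in> Mon. reparam x \<phi> \<in> dpaths X) \<and>
     (\<forall>x \<in> dpaths X. \<forall>y \<in> dpaths X. x 1 = y 0 \<longrightarrow> norm_comp x y \<in> dpaths X)"

definition saturated :: "'a dspace \<Rightarrow> bool" where
  "saturated X \<longleftrightarrow>
     (\<forall>x \<in> paths (underlying X). \<forall>\<phi> \<in> Rep. reparam x \<phi> \<in> dpaths X \<longrightarrow> x \<in> dpaths X)"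

section \<open>Path spaces and trace spaces\<close>

definition compact_open :: "'a topology \<Rightarrow> (real \<Rightarrow> 'a) topology" where
  "compact_open Y = topology_generated_by
     {{x \<in> paths Y. x ` K \<subseteq> U} | K U. K \<subseteq> {0..1} \<and> compact K \<and> openin Y U}"

lemma topspace_compact_open [simp]: "topspace (compact_open Y) = paths Y"
proof -
  have "paths Y \<in> {{x \<in> paths Y. x ` K \<subseteq> U} | K U. K \<subseteq> {0..1} \<and> compact K \<and> openin Y U}"
    by (force intro!: exI [of _ "{}"])
  then show ?thesis
    unfolding compact_open_def topology_generated_by_topspace by blast
qed

definition dpaths_between :: "'a dspace \<Rightarrow> 'a \<Rightarrow> 'a \<Rightarrow> (real \<Rightarrow> 'a) set" where
  "dpaths_between X u v = {x \<in> dpaths X. x 0 = u \<and> x 1 = v}"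

definition path_space :: "'a dspace \<Rightarrow> 'a \<Rightarrow> 'a \<Rightarrow> (real \<Rightarrow> 'a) topology" where
  "path_space X u v = k_Delta (subtopology (compact_open (underlying X)) (dpaths_between X u v))"

definition trace_equiv :: "'a dspace \<Rightarrow> (real \<Rightarrow> 'a) \<Rightarrow> (real \<Rightarrow> 'a) \<Rightarrow> bool" where
  "trace_equiv X = equivclp (\<lambda>x y. x \<in> dpaths X \<and> (\<exists>\<phi> \<in> Rep. y = reparam x \<phi>))"

text \<open>Reparametrization by \<open>Rep\<close> preserves endpoints, so for a directed path the class below
  consists of directed paths with the same endpoints.\<close>

definition trace_class :: "'a dspace \<Rightarrow> (real \<Rightarrow> 'a) \<Rightarrow> (real \<Rightarrow> 'a) set" where
  "trace_class X x = {y. trace_equiv X x y}"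

definition quotient_topology :: "'a topology \<Rightarrow> ('a \<Rightarrow> 'b) \<Rightarrow> 'b topology" where
  "quotient_topology Y q = topology (\<lambda>U. U \<subseteq> q ` topspace Y \<and> openin Y {x \<in> topspace Y. q x \<in> U})"

lemma openin_quotient_topology:
  "openin (quotient_topology Y q) U \<longleftrightarrow>
     U \<subseteq> q ` topspace Y \<and> openin Y {x \<in> topspace Y. q x \<in> U}"
proof -
  have "istopology (\<lambda>U. U \<subseteq> q ` topspace Y \<and> openin Y {x \<in> topspace Y. q x \<in> U})"
    (is "istopology ?P")
    unfolding istopology_def
  proof (intro conjI allI impI)
    fix S T assume S: "?P S" and T: "?P T"
    then show "S \<inter> T \<subseteq> q ` topspace Y" by blast
    have "{x \<in> topspace Y. q x \<in> S \<inter> T}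
        = {x \<in> topspace Y. q x \<in> S} \<inter> {x \<in> topspace Y. q x \<in> T}" by blast
    then show "openin Y {x \<in> topspace Y. q x \<in> S \<inter> T}"
      using S T by (simp add: openin_Int)
  next
    fix \<K> assume K: "\<forall>S\<in>\<K>. ?P S"
    then show "\<Union> \<K> \<subseteq> q ` topspace Y" by blast
    have "{x \<in> topspace Y. q x \<in> \<Union> \<K>} = (\<Union>S\<in>\<K>. {x \<in> topspace Y. q x \<in> S})" by blast
    moreover have "openin Y (\<Union>S\<in>\<K>. {x \<in> topspace Y. q x \<in> S})"
      using K by (intro openin_Union) blast
    ultimately show "openin Y {x \<in> topspace Y. q x \<in> \<Union> \<K>}" by simp
  qed
  then show ?thesis by (simp add: quotient_topology_def)
qed

lemma quotient_map_quotient_topology: "quotient_map Y (quotient_topology Y q) q"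
proof -
  have "{x \<in> topspace Y. q x \<in> q ` topspace Y} = topspace Y" by blast
  then have "openin (quotient_topology Y q) (q ` topspace Y)"
    by (simp add: openin_quotient_topology)
  then have "topspace (quotient_topology Y q) = q ` topspace Y"
    by (metis openin_quotient_topology openin_subset openin_topspace subset_antisym)
  then show ?thesis
    by (auto simp: quotient_map_def openin_quotient_topology)
qed

definition trace_space :: "'a dspace \<Rightarrow> 'a \<Rightarrow> 'a \<Rightarrow> (real \<Rightarrow> 'a) set topology" where
  "trace_space X u v = quotient_topology (path_space X u v) (trace_class X)"

section \<open>Trivial q-fibrations\<close>

definition disc :: "nat \<Rightarrow> (nat \<Rightarrow> real) topology" where
  "disc n = subtopology (Euclidean_space n) {x. (\<Sum>i<n. x i ^ 2) \<le> 1}"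

text \<open>The boundary sphere of dimension \<open>n - 1\<close>; unlike \<open>nsphere\<close> it is indexed by the dimension of
  the disc, and it is empty for \<open>n = 0\<close>.\<close>

definition bsphere :: "nat \<Rightarrow> (nat \<Rightarrow> real) topology" where
  "bsphere n = subtopology (Euclidean_space n) {x. (\<Sum>i<n. x i ^ 2) = 1}"

definition has_rlp :: "'c topology \<Rightarrow> 'd topology \<Rightarrow> ('c \<Rightarrow> 'd) \<Rightarrow>
    'a topology \<Rightarrow> 'b topology \<Rightarrow> ('a \<Rightarrow> 'b) \<Rightarrow> bool" where
  "has_rlp A B i E Z p \<longleftrightarrow>
     (\<forall>g h. continuous_map A E g \<and> continuous_map B Z h \<and>
            (\<forall>a \<in> topspace A. p (g a) = h (i a)) \<longrightarrow>
        (\<exists>l. continuous_map B E l \<and>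
             (\<forall>a \<in> topspace A. l (i a) = g a) \<and> (\<forall>b \<in> topspace B. p (l b) = h b)))"

definition trivial_q_fibration ::
    "Top_choice \<Rightarrow> 'a topology \<Rightarrow> 'b topology \<Rightarrow> ('a \<Rightarrow> 'b) \<Rightarrow> bool" where
  "trivial_q_fibration C E Z p \<longleftrightarrow>
     in_Top C E \<and> in_Top C Z \<and> continuous_map E Z p \<and>
     (\<forall>n. has_rlp (bsphere n) (disc n) id E Z p)"

end

theory Submission
  imports Defs
begin

text \<open>The traces parametrized by a compact space \<open>B\<close> sweep out a compact, hence metrizable, subset
  \<open>K\<close> of \<open>X\<close>. On paths in \<open>K\<close>, Morse's \<open>\<mu>\<close>-length is a continuous functional which is invariant under
  reparametrization and, along a path, is constant only where the path is. Saturation therefore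
  shows that two directed paths in \<open>K\<close> have the same trace exactly if they have the same
  parametrization \<open>L\<close> by \<open>\<mu>\<close>-length, and \<open>L\<close> depends continuously on the trace. In particular
  the traces in \<open>K\<close> form a Hausdorff closed subspace, which gives the \<open>\<Delta>\<close>-Hausdorff property. To lift a
  disc \<open>h\<close> of traces relative to a given lift \<open>g\<close> on the sphere, follow \<open>L (h b)\<close> with the length
  function of \<open>g\<close> extended radially over the disc. Working with unnormalized length avoids
  any division by the length, which vanishes at constant traces.\<close>

section \<open>General topology and \<open>\<Delta>\<close>-generated spaces\<close>

text \<open>Paths in K need not be rectifiable, and arc length is only lower semicontinuous under
  uniform convergence, so it cannot parametrize traces continuously. The \<mu>-length has neither
  defect: its n-th term looks at n jumps only, hence is a supremum over a compact set of
  configurations and varies continuously with the path and the time, and the weighted sum is at most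
  1. It does require a metric, which X as a whole may lack; hence K is chosen only after the
  interval or disc of traces is given. Compactness of K must be found without a continuous choice of
  representing paths, since such a choice is exactly what a lift would provide. A second obstacle is
  the continuity of L. It is obtained by descent from evaluation of paths, but the product of a
  quotient map with an identity need not be a quotient map. Time has no meaning on a trace, while
  length does; replacing time by length first leaves a product with the real line, which is locally
  compact, and there the product is a quotient map.\<close>

lemma continuous_map_SUP_compact:
  fixes F :: "'a \<times> 'b \<Rightarrow> real"
  assumes F: "continuous_map (prod_topology Z C) euclideanreal F"
    and C: "compact_space C" "topspace C \<noteq> {}"
  shows "continuous_map Z euclideanreal (\<lambda>z. SUP c\<in>topspace C. F (z, c))"
proof -
  define G where "G z = (SUP c\<in>topspace C. F (z, c))" for z
  have att: "\<exists>c\<in>topspace C. G z = F (z, c) \<and> (\<forall>c'\<in>topspace C. F (z, c') \<le> G z)"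
    if z: "z \<in> topspace Z" for z
  proof -
    have "continuous_map C euclideanreal (F \<circ> (\<lambda>c. (z, c)))"
      by (rule continuous_map_compose [OF _ F]) (use z in \<open>simp add: continuous_map_paired\<close>)
    then have "compact ((F \<circ> (\<lambda>c. (z, c))) ` topspace C)"
      using C(1) by (metis compact_space_def compactin_euclidean_iff image_compactin)
    then obtain c where c: "c \<in> topspace C" "\<And>c'. c' \<in> topspace C \<Longrightarrow> F (z, c') \<le> F (z, c)"
      using compact_attains_sup [of "(F \<circ> (\<lambda>c. (z, c))) ` topspace C"] C(2) by auto
    then have "G z = F (z, c)"
      unfolding G_def by (intro cSup_eq_maximum) auto
    with c show ?thesis by auto
  qed
  \<comment> \<open>The two halves of continuity use different projections: \<open>G > r\<close> is
    the image of an open set, and projections are open; since suprema are attained,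
    \<open>G \<ge> r\<close> is the image of a closed set along a compact factor, which is
    closed.\<close>
  have "continuous_map Z euclideanreal G"
    unfolding continuous_map_upper_lower_semicontinuous_lt
  proof (intro allI conjI)
    fix r
    have "openin (prod_topology Z C) {p \<in> topspace (prod_topology Z C). F p \<in> {r<..}}"
      by (rule openin_continuous_map_preimage [OF F]) simp
    then have "openin Z (fst ` {p \<in> topspace (prod_topology Z C). F p \<in> {r<..}})"
      using open_map_fst open_map_def by blast
    moreover have "fst ` {p \<in> topspace (prod_topology Z C). F p \<in> {r<..}}
        = {z \<in> topspace Z. r < G z}"
      using att by (fastforce simp: image_iff)
    ultimately show "openin Z {z \<in> topspace Z. r < G z}" by simp
    have "closedin (prod_topology Z C) {p \<in> topspace (prod_topology Z C). F p \<in> {r..}}"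
      by (rule closedin_continuous_map_preimage [OF F]) simp
    then have "closedin Z (fst ` {p \<in> topspace (prod_topology Z C). F p \<in> {r..}})"
      using closed_map_fst [OF C(1)] closed_map_def by blast
    then have "openin Z (topspace Z - fst ` {p \<in> topspace (prod_topology Z C). F p \<in> {r..}})"
      by blast
    moreover have "topspace Z - fst ` {p \<in> topspace (prod_topology Z C). F p \<in> {r..}}
        = {z \<in> topspace Z. G z < r}"
      using att by (force simp: image_iff not_le)
    ultimately show "openin Z {z \<in> topspace Z. G z < r}" by simp
  qed
  then show ?thesis unfolding G_def .
qed

text \<open>Near a zero of \<open>r\<close> the bound alone squeezes \<open>f\<close> to 0, whatever
  the behaviour of \<open>f\<close> elsewhere nearby. This handles radial extension at the centre of
  a disc, where the direction is undefined.\<close>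

lemma continuous_map_real_bounded_vanishing:
  fixes f r :: "'a \<Rightarrow> real"
  assumes r: "continuous_map X euclideanreal r"
    and f: "continuous_map (subtopology X {x. r x \<noteq> 0}) euclideanreal f"
    and bd: "\<And>x. x \<in> topspace X \<Longrightarrow> \<bar>f x\<bar> \<le> \<bar>r x\<bar>"
  shows "continuous_map X euclideanreal f"
  unfolding continuous_map_def
proof (intro conjI allI impI)
  fix U :: "real set" assume U: "openin euclideanreal U"
  let ?N = "{x \<in> topspace X. r x \<noteq> 0}"
  have N: "openin X ?N"
    using openin_continuous_map_preimage [OF r, of "- {0}"] by (simp add: open_Compl)
  have top: "topspace (subtopology X {x. r x \<noteq> 0}) = ?N"
    by auto
  have sub: "subtopology X {x. r x \<noteq> 0} = subtopology X ?N"
    by (simp add: subtopology_restrict Collect_conj_eq)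
  have 1: "openin X {x \<in> ?N. f x \<in> U}"
    using openin_continuous_map_preimage [OF f U] N unfolding top unfolding sub
    by (meson openin_trans_full)
  show "openin X {x \<in> topspace X. f x \<in> U}"
  proof (cases "0 \<in> U")
    case True
    then obtain e where e: "e > 0" "ball 0 e \<subseteq> U"
      using U open_contains_ball by (metis open_openin)
    have 2: "openin X {x \<in> topspace X. r x \<in> ball 0 e}"
      by (rule openin_continuous_map_preimage [OF r]) simp
    have "{x \<in> topspace X. f x \<in> U}
        = {x \<in> ?N. f x \<in> U} \<union> {x \<in> topspace X. r x \<in> ball 0 e}"
      using bd e True by (fastforce simp: subset_iff dist_norm)
    then show ?thesis using openin_Un [OF 1 2] by (simp only:)
  next
    case False
    then have "{x \<in> topspace X. f x \<in> U} = {x \<in> ?N. f x \<in> U}"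
      using bd by fastforce
    then show ?thesis using 1 by simp
  qed
qed simp

lemma separated_by_continuous_map:
  assumes f: "continuous_map Y Z f" and Z: "Hausdorff_space Z"
    and y: "y \<in> topspace Y" "y' \<in> topspace Y" and ne: "f y \<noteq> f y'"
  shows "\<exists>U V. openin Y U \<and> openin Y V \<and> y \<in> U \<and> y' \<in> V \<and> disjnt U V"
proof -
  have "f y \<in> topspace Z" "f y' \<in> topspace Z" using f y by (auto simp: continuous_map_def)
  then obtain U V where UV: "openin Z U" "openin Z V" "f y \<in> U" "f y' \<in> V" "disjnt U V"
    using Z ne unfolding Hausdorff_space_def by blast
  then have "disjnt {x \<in> topspace Y. f x \<in> U} {x \<in> topspace Y. f x \<in> V}"
    by (auto simp: disjnt_def)
  moreover have "openin Y {x \<in> topspace Y. f x \<in> U}" "openin Y {x \<in> topspace Y. f x \<in> V}"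
    using openin_continuous_map_preimage [OF f] UV by blast+
  ultimately show ?thesis using y UV by blast
qed

section \<open>The \<Delta>-generated refinement of a topology\<close>

lemma openin_k_Delta_finer: "openin Y U \<Longrightarrow> openin (k_Delta Y) U"
  unfolding openin_k_Delta using openin_continuous_map_preimage [of _ Y _ U] openin_subset [of Y U]
  by fastforce

lemma continuous_map_into_k_Delta_simplex:
  assumes "continuous_map (subtopology (powertop_real UNIV) (standard_simplex p)) Y f"
  shows "continuous_map (subtopology (powertop_real UNIV) (standard_simplex p)) (k_Delta Y) f"
  using assms unfolding continuous_map_def
  by (auto simp: openin_k_Delta continuous_map_def)

text \<open>Composing with \<pi> turns \<open>f\<close> into a map from a simplex, for which the
  refinement makes no difference, and continuity descends along the quotient. For discs this allows
  lifts to be constructed in the compact-open topology.\<close>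

lemma continuous_map_into_k_Delta:
  assumes p: "quotient_map (subtopology (powertop_real UNIV) (standard_simplex p)) B \<pi>"
    and f: "continuous_map B Y f"
  shows "continuous_map B (k_Delta Y) f"
proof -
  have "continuous_map (subtopology (powertop_real UNIV) (standard_simplex p)) (k_Delta Y) (f \<circ> \<pi>)"
    by (intro continuous_map_into_k_Delta_simplex continuous_map_compose [OF quotient_imp_continuous_map [OF p] f])
  then show ?thesis
    using continuous_compose_quotient_map p by blast
qed

lemma continuous_map_k_Delta_id: "continuous_map (k_Delta Y) Y id"
proof -
  have "openin (k_Delta Y) {x \<in> topspace Y. x \<in> U}" if "openin Y U" for U
  proof -
    have "{x \<in> topspace Y. x \<in> U} = U" using openin_subset [OF that] by auto
    then show ?thesis using openin_k_Delta_finer [OF that] by simp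
  qed
  then show ?thesis by (simp add: continuous_map_def)
qed

lemma Delta_generated_k_Delta: "Delta_generated (k_Delta Y)"
  unfolding Delta_generated_def topology_eq
proof (intro allI iffI)
  fix U assume "openin (k_Delta (k_Delta Y)) U"
  then show "openin (k_Delta Y) U"
    unfolding openin_k_Delta [of "k_Delta Y"] openin_k_Delta [of Y]
    by (auto intro: continuous_map_into_k_Delta_simplex)
qed (rule openin_k_Delta_finer)

lemma Hausdorff_space_k_Delta: "Hausdorff_space Y \<Longrightarrow> Hausdorff_space (k_Delta Y)"
  by (rule Hausdorff_space_expansive [of Y]) (auto simp: openin_k_Delta_finer)

text \<open>Every test simplex in \<open>Y\<close> gives one in \<open>Z\<close> by composition with
  \<open>q\<close>, so preimages of \<open>k_Delta\<close>-open sets are \<open>k_Delta\<close>-open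
  in \<open>Y\<close>, that is, open.\<close>

lemma Delta_generated_quotient:
  assumes Y: "Delta_generated Y" and q: "quotient_map Y Z q"
  shows "Delta_generated Z"
  unfolding Delta_generated_def topology_eq
proof (intro allI iffI)
  fix U assume U: "openin (k_Delta Z) U"
  then have UZ: "U \<subseteq> topspace Z" by (simp add: openin_k_Delta)
  have "openin (k_Delta Y) {y \<in> topspace Y. q y \<in> U}"
    unfolding openin_k_Delta
  proof (intro conjI allI impI)
    fix p f
    assume f: "continuous_map (subtopology (powertop_real UNIV) (standard_simplex p)) Y f"
    then have "f ` standard_simplex p \<subseteq> topspace Y"
      using continuous_map_image_subset_topspace by fastforce
    then have "{x \<in> standard_simplex p. f x \<in> {y \<in> topspace Y. q y \<in> U}}
        = {x \<in> standard_simplex p. (q \<circ> f) x \<in> U}" by auto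
    moreover have "continuous_map (subtopology (powertop_real UNIV) (standard_simplex p)) Z (q \<circ> f)"
      using f q continuous_map_compose quotient_imp_continuous_map by blast
    ultimately show "openin (subtopology (powertop_real UNIV) (standard_simplex p))
       {x \<in> standard_simplex p. f x \<in> {y \<in> topspace Y. q y \<in> U}}"
      using U unfolding openin_k_Delta [of Z] by (simp only:)
  qed auto
  then show "openin Z U"
    using Y q UZ unfolding Delta_generated_def quotient_map_def by simp
qed (rule openin_k_Delta_finer)

lemma Hausdorff_space_imp_Delta_Hausdorff: "Hausdorff_space Y \<Longrightarrow> Delta_Hausdorff Y"
  by (simp add: Delta_Hausdorff_def compactin_imp_closedin compactin_path_image)

section \<open>Discs and spheres\<close>

lemma topspace_disc: "topspace (disc n) = {x. (\<forall>i\<ge>n. x i = 0) \<and> (\<Sum>i<n. x i ^ 2) \<le> 1}"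
  by (auto simp: disc_def topspace_Euclidean_space)

lemma topspace_bsphere: "topspace (bsphere n) = {x. (\<forall>i\<ge>n. x i = 0) \<and> (\<Sum>i<n. x i ^ 2) = 1}"
  by (auto simp: bsphere_def topspace_Euclidean_space)

lemma continuous_map_disc_coord [continuous_intros]: "continuous_map (disc n) euclideanreal (\<lambda>x. x i)"
  unfolding disc_def Euclidean_space_def
  by (intro continuous_map_from_subtopology continuous_map_product_projection) auto

lemma continuous_map_into_disc:
  assumes "\<And>i. continuous_map Z euclideanreal (\<lambda>z. f z i)"
    and "\<And>z. z \<in> topspace Z \<Longrightarrow> f z \<in> topspace (disc n)"
  shows "continuous_map Z (disc n) f"
  using assms unfolding topspace_disc unfolding disc_def Euclidean_space_def
  by (auto simp: continuous_map_in_subtopology continuous_map_componentwise_UNIV)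

lemma continuous_map_into_bsphere:
  assumes "\<And>i. continuous_map Z euclideanreal (\<lambda>z. f z i)"
    and "\<And>z. z \<in> topspace Z \<Longrightarrow> f z \<in> topspace (bsphere n)"
  shows "continuous_map Z (bsphere n) f"
  using assms unfolding topspace_bsphere unfolding bsphere_def Euclidean_space_def
  by (auto simp: continuous_map_in_subtopology continuous_map_componentwise_UNIV)

lemma Hausdorff_space_disc: "Hausdorff_space (disc n)"
  unfolding disc_def Euclidean_space_def
  by (intro Hausdorff_space_subtopology) (simp add: Hausdorff_space_product_topology)

text \<open>No homeomorphism is constructed: a continuous surjection from a compact space onto a
  Hausdorff space is a quotient map. The surjection blows up the first n simplex coordinates until
  they cover the disc and then retracts radially.\<close>

lemma disc_quotient_of_simplex:
  obtains \<pi> where "quotient_map (subtopology (powertop_real UNIV) (standard_simplex n)) (disc n) \<pi>"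
proof -
  let ?S = "subtopology (powertop_real UNIV) (standard_simplex n)"
  \<comment> \<open>A point of the disc has coordinates in [-1,1], so its preimage needs n
    coordinates of at most 2/c each. Their sum 2n/c must not exceed 1, as the last simplex
    coordinate takes the remainder; the extra 1 keeps c positive for n = 0.\<close>
  define c where "c = 2 * real n + 1"
  define \<alpha> where "\<alpha> x i = (if i < n then c * x i - 1 else 0)" for x :: "nat \<Rightarrow> real" and i
  \<comment> \<open>The maximum with 1 makes the retraction the identity on the disc and keeps the
    denominator away from 0.\<close>
  define \<rho> where "\<rho> x = max 1 (sqrt (\<Sum>i<n. \<alpha> x i ^ 2))" for x :: "nat \<Rightarrow> real"
  define \<pi> where "\<pi> x i = \<alpha> x i / \<rho> x" for x i
  have coord: "continuous_map ?S euclideanreal (\<lambda>x. x i)" for i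
    by (intro continuous_map_from_subtopology continuous_map_product_projection) auto
  have \<alpha>: "continuous_map ?S euclideanreal (\<lambda>x. \<alpha> x i)" for i
    unfolding \<alpha>_def by (cases "i < n") (auto intro!: continuous_intros coord)
  have "continuous_map ?S euclideanreal \<rho>"
    unfolding \<rho>_def by (intro continuous_intros \<alpha>) auto
  moreover have "\<rho> x \<ge> 1" for x by (simp add: \<rho>_def)
  then have \<rho>0: "\<rho> x \<noteq> 0" "\<rho> x > 0" for x by (smt (verit))+
  ultimately have cont: "continuous_map ?S euclideanreal (\<lambda>x. \<pi> x i)" for i
    unfolding \<pi>_def by (intro continuous_intros \<alpha>) auto
  have in_disc: "\<pi> x \<in> topspace (disc n)" for x
  proof -
    have "sqrt (\<Sum>i<n. \<alpha> x i ^ 2) \<le> \<rho> x" by (simp add: \<rho>_def)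
    then have "(\<Sum>i<n. \<alpha> x i ^ 2) \<le> (\<rho> x)\<^sup>2"
      using \<rho>0 sqrt_le_D by blast
    moreover have "(\<Sum>i<n. \<pi> x i ^ 2) = (\<Sum>i<n. \<alpha> x i ^ 2) / (\<rho> x)\<^sup>2"
      by (simp add: \<pi>_def power_divide sum_divide_distrib)
    ultimately have "(\<Sum>i<n. \<pi> x i ^ 2) \<le> 1" using \<rho>0 [of x] by (simp add: divide_le_eq)
    then show ?thesis by (auto simp: topspace_disc \<pi>_def \<alpha>_def)
  qed
  have surj: "y \<in> \<pi> ` standard_simplex n" if y: "y \<in> topspace (disc n)" for y
  proof -
    define x where "x i = (if i < n then (y i + 1) / c else if i = n then 1 - (\<Sum>i<n. (y i + 1) / c) else 0)" for i
    have c: "c > 0" by (simp add: c_def)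
    have sq: "(\<Sum>i<n. y i ^ 2) \<le> 1" and y0: "\<And>i. i \<ge> n \<Longrightarrow> y i = 0"
      using y by (auto simp: topspace_disc)
    have "y i ^ 2 \<le> 1" if "i < n" for i
      using sq member_le_sum [of i "{..<n}" "\<lambda>i. y i ^ 2"] that by simp
    then have yb: "\<bar>y i\<bar> \<le> 1" if "i < n" for i
      using that by (simp add: abs_square_le_1)
    have sum: "(\<Sum>i<n. (y i + 1) / c) \<le> 1"
    proof -
      have "(\<Sum>i<n. (y i + 1)) \<le> (\<Sum>i<n. 2)"
        by (rule sum_mono) (use yb in \<open>force simp: abs_le_iff\<close>)
      then have "(\<Sum>i<n. (y i + 1)) \<le> c" by (simp add: c_def)
      then show ?thesis using c by (simp add: divide_le_eq flip: sum_divide_distrib)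
    qed
    have nonneg: "0 \<le> x i" for i
      using yb [of i] c sum by (auto simp: x_def abs_le_iff)
    have sx: "(\<Sum>i\<le>n. x i) = 1"
      by (simp add: x_def atMost_Suc lessThan_Suc_atMost [symmetric])
    have "x i \<le> 1" for i
    proof (cases "i \<le> n")
      case True
      then show ?thesis using member_le_sum [of i "{..n}" x] nonneg sx by simp
    qed (simp add: x_def)
    then have xs: "x \<in> standard_simplex n"
      using nonneg sx by (auto simp: standard_simplex_def x_def)
    have \<alpha>x: "\<alpha> x = y"
      using c y0 by (auto simp: \<alpha>_def x_def fun_eq_iff)
    then have "\<rho> x = 1"
      using sq by (simp add: \<rho>_def max_absorb1)
    then have "\<pi> x = y" by (simp add: \<pi>_def \<alpha>x fun_eq_iff)
    with xs show ?thesis by blast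
  qed
  have "continuous_map ?S (disc n) \<pi>"
    by (rule continuous_map_into_disc) (use cont in_disc in auto)
  moreover have "compact_space ?S"
    using compactin_standard_simplex compactin_subspace by blast
  moreover have "\<pi> ` topspace ?S = topspace (disc n)"
    using in_disc surj by auto
  ultimately have "quotient_map ?S (disc n) \<pi>"
    using Hausdorff_space_disc T1_Spaces.continuous_imp_quotient_map by blast
  then show thesis by (rule that)
qed

lemma compact_space_disc: "compact_space (disc n)"
proof -
  obtain \<pi> where \<pi>: "quotient_map (subtopology (powertop_real UNIV) (standard_simplex n)) (disc n) \<pi>"
    by (rule disc_quotient_of_simplex)
  have "compactin (subtopology (powertop_real UNIV) (standard_simplex n)) (standard_simplex n)"
    by (simp add: compactin_subtopology compactin_standard_simplex)
  from image_compactin [OF this quotient_imp_continuous_map [OF \<pi>]] show ?thesis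
    using quotient_imp_surjective_map [OF \<pi>] by (simp add: compact_space_def)
qed

section \<open>Morse's \<open>\<mu>\<close>-length\<close>

text \<open>\<open>mu d n x t\<close> is the supremum of the \<open>r \<le> 1\<close> such that \<open>x\<close>, restricted to \<open>{0..t}\<close>, makes \<open>n\<close> successive
  jumps of size at least \<open>r\<close>.\<close>

fun mu :: "('a \<Rightarrow> 'a \<Rightarrow> real) \<Rightarrow> nat \<Rightarrow> (real \<Rightarrow> 'a) \<Rightarrow> real \<Rightarrow> real" where
  "mu d 0 x t = 1"
| "mu d (Suc n) x t =
     (SUP p\<in>{(a, b). 0 \<le> a \<and> a \<le> b \<and> b \<le> t}. min (mu d n x (fst p)) (d (x (fst p)) (x (snd p))))"

declare mu.simps [simp del]

text \<open>The series starts with one jump because \<open>mu d 0\<close> is constantly 1, while the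
  length at time 0 has to vanish. The weights give uniform convergence and the bound 1, which later
  controls the radial extension of lengths.\<close>

definition mu_length :: "('a \<Rightarrow> 'a \<Rightarrow> real) \<Rightarrow> (real \<Rightarrow> 'a) \<Rightarrow> real \<Rightarrow> real" where
  "mu_length d x t = suminf (\<lambda>n. mu d (Suc n) x t * (1/2) ^ Suc n)"

lemma Rep_endpoints:
  assumes "\<phi> \<in> Rep" shows "\<phi> 0 = 0" "\<phi> 1 = 1"
proof -
  have m: "mono_on {0..1} \<phi>" and im: "\<phi> ` {0..1} = {0..1}"
    using assms by (auto simp: Rep_def)
  have *: "\<exists>s\<in>{0..1}. \<phi> s = r" and **: "\<phi> r \<in> {0..1}" if "r \<in> {0..1}" for r
    using that im by (metis imageE, metis imageI)
  show "\<phi> 0 = 0"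
    using * [of 0] ** [of 0] mono_onD [OF m, of 0] by fastforce
  show "\<phi> 1 = 1"
    using * [of 1] ** [of 1] mono_onD [OF m, of _ 1] by fastforce
qed

lemma RepI:
  assumes "continuous_on {0..1} \<phi>" "mono_on {0..1} \<phi>" "\<phi> 0 = 0" "\<phi> 1 = 1"
  shows "\<phi> \<in> Rep"
proof -
  have "\<phi> t \<in> {0..1}" if "t \<in> {0..1}" for t
    using that mono_onD [OF assms(2), of 0 t] mono_onD [OF assms(2), of t 1] assms(3,4) by auto
  moreover have "s \<in> \<phi> ` {0..1}" if "s \<in> {0..1}" for s
    using IVT' [of \<phi> 0 s 1] assms that by force
  ultimately show ?thesis using assms(1,2) by (auto simp: Rep_def)
qed

context Metric_space
begin

lemma mu_range:
  assumes "0 \<le> t" shows "0 \<le> mu d n x t" "mu d n x t \<le> 1"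
proof -
  have "0 \<le> mu d n x t \<and> mu d n x t \<le> 1"
    using assms
  proof (induction n arbitrary: t)
    case (Suc n)
    let ?S = "{(a, b). 0 \<le> a \<and> a \<le> b \<and> b \<le> t}"
    let ?f = "\<lambda>p. min (mu d n x (fst p)) (d (x (fst p)) (x (snd p)))"
    have f: "0 \<le> ?f p \<and> ?f p \<le> 1" if "p \<in> ?S" for p
      using Suc.IH [of "fst p"] that by (auto simp: min_le_iff_disj)
    have 0: "(0, 0) \<in> ?S" using Suc.prems by auto
    have "(SUP p\<in>?S. ?f p) \<le> 1" using f 0 by (intro cSUP_least) blast+
    moreover have "bdd_above (?f ` ?S)" using f by (intro bdd_aboveI2 [where M = 1]) blast
    then have "?f (0, 0) \<le> (SUP p\<in>?S. ?f p)" using 0 by (intro cSUP_upper)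
    ultimately show ?case using f [OF 0] unfolding mu.simps by linarith
  qed (simp add: mu.simps)
  then show "0 \<le> mu d n x t" "mu d n x t \<le> 1" by auto
qed

lemma mu_bdd_above:
  "bdd_above ((\<lambda>p. min (mu d n x (fst p)) (d (x (fst p)) (x (snd p)))) ` {(a, b). 0 \<le> a \<and> a \<le> b \<and> b \<le> t})"
  by (rule bdd_aboveI2 [where M = 1]) (auto simp: min_le_iff_disj mu_range)

lemma mu_Suc_ge:
  assumes "0 \<le> a" "a \<le> b" "b \<le> t"
  shows "min (mu d n x a) (d (x a) (x b)) \<le> mu d (Suc n) x t"
  using cSUP_upper [OF _ mu_bdd_above, of "(a, b)" t n x] assms by (simp add: mu.simps)

lemma mu_Suc_gtD:
  assumes "r < mu d (Suc n) x t" "0 \<le> t"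
  obtains a b where "0 \<le> a" "a \<le> b" "b \<le> t" "r < mu d n x a" "r < d (x a) (x b)"
proof -
  have "{(a, b). 0 \<le> a \<and> a \<le> b \<and> b \<le> t} \<noteq> {}" using assms(2) by auto
  then show thesis
    using assms(1) that unfolding mu.simps by (auto simp: less_cSUP_iff [OF _ mu_bdd_above])
qed

lemma mu_mono:
  assumes "0 \<le> s" "s \<le> t" shows "mu d n x s \<le> mu d n x t"
proof (cases n)
  case (Suc m)
  show ?thesis unfolding Suc mu.simps
    by (rule cSUP_subset_mono) (use assms mu_bdd_above in auto)
qed (simp add: mu.simps)

lemma mu_Suc_0:
  assumes "x 0 \<in> M" shows "mu d (Suc n) x 0 = 0"
proof -
  have "{(a, b). 0 \<le> a \<and> a \<le> b \<and> b \<le> (0::real)} = {(0, 0)}" by auto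
  then show ?thesis using assms mu_range [of 0 n x] by (simp add: mu.simps)
qed

text \<open>A monotone surjection maps the index set of the supremum at t onto the one at \<phi> t.
  Preimages are found by the intermediate value theorem, first for b and then for a within [0,b], so
  that their order is kept.\<close>

lemma mu_reparam:
  assumes \<phi>: "\<phi> \<in> Rep" and t: "t \<in> {0..1}"
  shows "mu d n (reparam x \<phi>) t = mu d n x (\<phi> t)"
  using t
proof (induction n arbitrary: t)
  case (Suc n)
  have cont: "continuous_on {0..1} \<phi>" and mono: "mono_on {0..1} \<phi>"
    using \<phi> by (auto simp: Rep_def)
  note [simp] = Rep_endpoints [OF \<phi>]
  let ?S = "\<lambda>t::real. {(a, b). 0 \<le> a \<and> a \<le> b \<and> b \<le> t}"
  have im: "?S (\<phi> t) = map_prod \<phi> \<phi> ` ?S t"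
  proof (intro equalityI subsetI)
    fix p assume "p \<in> ?S (\<phi> t)"
    then obtain a' b' where p: "p = (a', b')" "0 \<le> a'" "a' \<le> b'" "b' \<le> \<phi> t" by auto
    have "continuous_on {0..t} \<phi>" using cont Suc.prems continuous_on_subset by fastforce
    then obtain b where b: "0 \<le> b" "b \<le> t" "\<phi> b = b'"
      using IVT' [of \<phi> 0 b' t] p Suc.prems by auto
    have "continuous_on {0..b} \<phi>" using cont b Suc.prems continuous_on_subset by fastforce
    then obtain a where "0 \<le> a" "a \<le> b" "\<phi> a = a'"
      using IVT' [of \<phi> 0 a' b] p b by auto
    with b p show "p \<in> map_prod \<phi> \<phi> ` ?S t" by (force simp: image_iff)
  next
    fix p assume "p \<in> map_prod \<phi> \<phi> ` ?S t"
    then obtain a b where p: "p = (\<phi> a, \<phi> b)" "0 \<le> a" "a \<le> b" "b \<le> t" by auto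
    then show "p \<in> ?S (\<phi> t)"
      using mono_onD [OF mono, of 0 a] mono_onD [OF mono, of a b] mono_onD [OF mono, of b t] Suc.prems
      by auto
  qed
  show ?case
    unfolding mu.simps im image_image
  proof (rule SUP_cong [OF refl])
    fix p assume "p \<in> ?S t"
    then obtain a b where p: "p = (a, b)" "a \<in> {0..1}" "b \<in> {0..1}" using Suc.prems by auto
    have "reparam x \<phi> c = x (\<phi> c)" if "c \<in> {0..1}" for c using that by (simp add: reparam_def)
    with p     show "min (mu d n (reparam x \<phi>) (fst p)) (d (reparam x \<phi> (fst p)) (reparam x \<phi> (snd p)))
        = min (mu d n x (fst (map_prod \<phi> \<phi> p))) (d (x (fst (map_prod \<phi> \<phi> p))) (x (snd (map_prod \<phi> \<phi> p))))"
      using Suc.IH [of a] by simp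
  qed
qed (simp add: mu.simps)

text \<open>Successive jumps occupy non-overlapping time intervals, and a jump larger than e takes
  at least \<eta> of time. So long chains of large jumps do not fit into the unit interval.\<close>

lemma mu_small:
  assumes unif: "\<And>a b. \<lbrakk>0 \<le> a; a \<le> b; b \<le> 1; b - a < \<eta>\<rbrakk> \<Longrightarrow> d (x a) (x b) \<le> e"
    and t: "t \<in> {0..1}" and gt: "e < mu d n x t"
  shows "real n * \<eta> \<le> t"
  using t gt
proof (induction n arbitrary: t)
  case (Suc n)
  then obtain a b where ab: "0 \<le> a" "a \<le> b" "b \<le> t" "e < mu d n x a" "e < d (x a) (x b)"
    using mu_Suc_gtD [of e n x t] by auto
  then have "real n * \<eta> \<le> a" using Suc by auto
  moreover have "b - a \<ge> \<eta>" using unif [of a b] ab Suc.prems by force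
  ultimately show ?case using ab by (simp add: algebra_simps)
qed auto

lemma continuous_map_d:
  assumes "continuous_map X mtopology f" "continuous_map X mtopology g"
  shows "continuous_map X euclideanreal (\<lambda>x. d (f x) (g x))"
  using continuous_map_mdist [of X "metric (M, d)" f g] assms by simp

text \<open>The real function sending (a,b) to the distance of \<open>x a\<close> and
  \<open>x b\<close> is uniformly continuous on the compact square; (a,b) is compared with the
  diagonal point (a,a), where it vanishes.\<close>

lemma path_uniformly_continuous:
  assumes x: "pathin mtopology x" and e: "0 < e"
  obtains \<eta> where "0 < \<eta>" "\<And>a b. \<lbrakk>0 \<le> a; a \<le> b; b \<le> 1; b - a < \<eta>\<rbrakk> \<Longrightarrow> d (x a) (x b) \<le> e"
proof -
  let ?I = "top_of_set {0..1::real}"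
  have x': "continuous_map ?I mtopology x" using x by (simp add: pathin_def)
  have xM: "x t \<in> M" if "t \<in> {0..1}" for t
    using continuous_map_image_subset_topspace [OF x'] that by auto
  have "continuous_map (prod_topology ?I ?I) euclideanreal (\<lambda>p. d (x (fst p)) (x (snd p)))"
    by (intro continuous_map_d continuous_map_compose [OF continuous_map_fst x', unfolded o_def]
        continuous_map_compose [OF continuous_map_snd x', unfolded o_def])
  then have "continuous_on ({0..1} \<times> {0..1}) (\<lambda>p. d (x (fst p)) (x (snd p)))"
    by (simp add: prod_topology_subtopology_eu)
  then have "uniformly_continuous_on ({0..1} \<times> {0..1}) (\<lambda>p. d (x (fst p)) (x (snd p)))"
    by (intro compact_uniformly_continuous compact_Times) auto
  then obtain \<eta> where \<eta>: "\<eta> > 0" and U: "\<And>p q. \<lbrakk>p \<in> {0..1} \<times> {0..1}; q \<in> {0..1} \<times> {0..1}; dist q p < \<eta>\<rbrakk>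
       \<Longrightarrow> dist (d (x (fst q)) (x (snd q))) (d (x (fst p)) (x (snd p))) < e"
    unfolding uniformly_continuous_on_def using e by metis
  show thesis
  proof
    fix a b :: real assume ab: "0 \<le> a" "a \<le> b" "b \<le> 1" "b - a < \<eta>"
    then show "d (x a) (x b) \<le> e"
      using U [of "(a, a)" "(a, b)"] xM [of a] by (auto simp: dist_Pair_Pair dist_real_def)
  qed fact
qed

lemma summable_mu: "0 \<le> t \<Longrightarrow> summable (\<lambda>n. mu d (Suc n) x t * (1/2) ^ Suc n)"
  by (rule summable_comparison_test' [OF summable_mult [OF summable_geometric [of "1/2::real"], of "1/2"], of 0])
    (auto simp: mu_range abs_mult mult_left_le_one_le)

lemma mu_length_mono:
  assumes "0 \<le> s" "s \<le> t" shows "mu_length d x s \<le> mu_length d x t"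
  unfolding mu_length_def using assms by (intro suminf_le summable_mu mult_right_mono mu_mono) auto

lemma mu_length_0: "x 0 \<in> M \<Longrightarrow> mu_length d x 0 = 0"
  by (simp add: mu_length_def mu_Suc_0)

lemma mu_length_le_1:
  assumes "0 \<le> t" shows "mu_length d x t \<le> 1"
proof -
  have "mu_length d x t \<le> suminf (\<lambda>n. (1/2) ^ Suc n)"
    unfolding mu_length_def using assms power_half_series
    by (intro suminf_le summable_mu) (auto simp: mu_range sums_iff)
  then show ?thesis using power_half_series by (simp add: sums_iff)
qed

lemma mu_length_reparam:
  "\<lbrakk>\<phi> \<in> Rep; t \<in> {0..1}\<rbrakk> \<Longrightarrow> mu_length d (reparam x \<phi>) t = mu_length d x (\<phi> t)"
  by (simp add: mu_length_def mu_reparam)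

lemma mu_length_eq_imp:
  assumes x: "pathin mtopology x" and st: "0 \<le> s" "s \<le> t" "t \<le> 1"
    and eq: "mu_length d x s = mu_length d x t"
  shows "x s = x t"
proof (rule ccontr)
  assume ne: "x s \<noteq> x t"
  have xM: "x t \<in> M" if "t \<in> {0..1}" for t
    using x that unfolding pathin_def by (auto simp: continuous_map_def)
  \<comment> \<open>The cap at 1 gives \<open>mu d 0 x s = 1 \<ge> \<delta>\<close>, so the least
    index k below is not 0 and has a predecessor.\<close>
  define \<delta> where "\<delta> = min 1 (d (x s) (x t))"
  have \<delta>: "0 < \<delta>" "\<delta> \<le> 1" "\<delta> \<le> d (x s) (x t)"
    using ne xM [of s] xM [of t] st by (auto simp: \<delta>_def)
  have "(\<lambda>n. (mu d (Suc n) x t - mu d (Suc n) x s) * (1/2) ^ Suc n) sums (mu_length d x t - mu_length d x s)"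
    unfolding left_diff_distrib mu_length_def using st by (intro sums_diff summable_sums summable_mu) auto
  \<comment> \<open>No term of the series decreases from s to t, so equal sums force equal
    terms.\<close>
  then have "(mu d (Suc n) x t - mu d (Suc n) x s) * (1/2) ^ Suc n = 0" for n
    using st eq suminf_eq_zero_iff [of "\<lambda>n. (mu d (Suc n) x t - mu d (Suc n) x s) * (1/2) ^ Suc n"]
    by (simp add: sums_iff mu_mono)
  then have same: "mu d (Suc n) x t = mu d (Suc n) x s" for n by simp
  \<comment> \<open>For the least \<open>k\<close> with \<open>mu d k x s < \<delta>\<close>, the jump from \<open>s\<close> to \<open>t\<close> prolongs a chain of \<open>k - 1\<close> jumps
    of size \<open>\<delta>\<close>, so that \<open>mu d k x\<close> increases strictly from \<open>s\<close> to \<open>t\<close>.\<close>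
  obtain \<eta> where \<eta>: "0 < \<eta>" "\<And>a b. \<lbrakk>0 \<le> a; a \<le> b; b \<le> 1; b - a < \<eta>\<rbrakk> \<Longrightarrow> d (x a) (x b) \<le> \<delta>/2"
    using path_uniformly_continuous [OF x, of "\<delta>/2"] \<delta>(1) by auto
  \<comment> \<open>For such n, a chain of n jumps larger than \<delta>/2 would last longer than 1,
    so some \<open>mu d n x s\<close> lies below \<delta>.\<close>
  obtain n where "1 < real n * \<eta>" using reals_Archimedean3 [OF \<eta>(1)] by blast
  then have "\<not> \<delta>/2 < mu d n x s" using mu_small [of \<eta> x "\<delta>/2" s n] \<eta>(2) st by force
  then have ex: "\<exists>n. mu d n x s < \<delta>" using \<delta>(1) by (intro exI [of _ n]) linarith
  define k where "k = (LEAST n. mu d n x s < \<delta>)"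
  have k: "mu d k x s < \<delta>" unfolding k_def using ex by (rule LeastI_ex)
  then obtain j where j: "k = Suc j" using \<delta>(2) by (cases k) (auto simp: mu.simps)
  then have "\<delta> \<le> mu d j x s" using not_less_Least [of j "\<lambda>n. mu d n x s < \<delta>"] by (simp flip: k_def)
  then have "\<delta> \<le> mu d k x t"
    using mu_Suc_ge [of s t t j x] st \<delta>(3) j by simp
  then show False using k same [of j] j by simp
qed

text \<open>Induction on the number of jumps. The supremum runs over a triangle that varies with the
  time; rewriting it over a fixed compact square makes continuity of suprema over a compact
  parameter applicable.\<close>

lemma continuous_map_mu:
  assumes ev: "continuous_map (prod_topology Z (top_of_set {0..1})) mtopology (\<lambda>p. \<xi> (fst p) (snd p))"
  shows "continuous_map (prod_topology Z (top_of_set {0..1})) euclideanreal (\<lambda>p. mu d n (\<xi> (fst p)) (snd p))"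
proof (induction n)
  case 0
  then show ?case by (simp add: mu.simps)
next
  case (Suc n)
  let ?I = "top_of_set {0..1::real}"
  let ?ZI = "prod_topology Z ?I" and ?J = "prod_topology ?I ?I"
  \<comment> \<open>With q = ((z,t),(a,b)), b is clipped at t, and a is then clipped at the result.
    This maps the square onto the triangle \<open>0 \<le> a \<le> b \<le> t\<close> and fixes each
    point already in it.\<close>
  define \<beta> where "\<beta> q = min (snd (snd q)) (snd (fst q))" for q :: "('b \<times> real) \<times> real \<times> real"
  define \<alpha> where "\<alpha> q = min (fst (snd q)) (\<beta> q)" for q :: "('b \<times> real) \<times> real \<times> real"
  have I: "continuous_map (prod_topology ?ZI ?J) ?ZI (\<lambda>q. (fst (fst q), \<gamma> q))"
    if "continuous_map (prod_topology ?ZI ?J) euclideanreal \<gamma>"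
      "\<And>q. q \<in> topspace (prod_topology ?ZI ?J) \<Longrightarrow> \<gamma> q \<in> {0..1}" for \<gamma>
    using that
    by (intro continuous_map_pairedI continuous_map_into_subtopology
        continuous_map_compose [OF continuous_map_fst continuous_map_fst, unfolded o_def]) auto
  have proj: "continuous_map (prod_topology ?ZI ?J) euclideanreal (\<lambda>q. snd (fst q))"
    "continuous_map (prod_topology ?ZI ?J) euclideanreal (\<lambda>q. fst (snd q))"
    "continuous_map (prod_topology ?ZI ?J) euclideanreal (\<lambda>q. snd (snd q))"
    using continuous_map_compose [OF continuous_map_fst continuous_map_snd, of Z ?I ?J, unfolded o_def]
      continuous_map_compose [OF continuous_map_snd continuous_map_fst, of ?ZI ?I ?I, unfolded o_def]
      continuous_map_compose [OF continuous_map_snd continuous_map_snd, of ?ZI ?I ?I, unfolded o_def]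
    by (auto intro: continuous_map_into_fulltopology)
  have b: "continuous_map (prod_topology ?ZI ?J) ?ZI (\<lambda>q. (fst (fst q), \<beta> q))"
    unfolding \<beta>_def by (rule I, intro continuous_intros proj) auto
  have a: "continuous_map (prod_topology ?ZI ?J) ?ZI (\<lambda>q. (fst (fst q), \<alpha> q))"
    unfolding \<alpha>_def \<beta>_def by (rule I, intro continuous_intros proj) auto
  let ?F = "\<lambda>q. min (mu d n (\<xi> (fst (fst q))) (\<alpha> q)) (d (\<xi> (fst (fst q)) (\<alpha> q)) (\<xi> (fst (fst q)) (\<beta> q)))"
  have "continuous_map (prod_topology ?ZI ?J) euclideanreal ?F"
    using continuous_map_compose [OF a Suc] continuous_map_compose [OF a ev] continuous_map_compose [OF b ev]
    unfolding o_def by (intro continuous_map_real_min continuous_map_d) auto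
  moreover have "compact_space ?J" by (simp add: compact_space_subtopology compact_Times)
  ultimately have "continuous_map ?ZI euclideanreal (\<lambda>p. SUP c\<in>topspace ?J. ?F (p, c))"
    by (intro continuous_map_SUP_compact) auto
  moreover have "(SUP c\<in>topspace ?J. ?F (p, c)) = mu d (Suc n) (\<xi> (fst p)) (snd p)"
    if p: "p \<in> topspace ?ZI" for p
  proof -
    obtain z t where zt: "p = (z, t)" "t \<in> {0..1}" using p by auto
    have im: "{(a, b). 0 \<le> a \<and> a \<le> b \<and> b \<le> t} = (\<lambda>c. (\<alpha> (p, c), \<beta> (p, c))) ` topspace ?J"
      (is "?S = ?R")
    proof (intro equalityI subsetI)
      fix q assume "q \<in> ?S"
      then obtain a b where q: "q = (a, b)" "0 \<le> a" "a \<le> b" "b \<le> t" by auto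
      then have "q = (\<alpha> (p, q), \<beta> (p, q))" "q \<in> topspace ?J"
        using zt by (auto simp: \<alpha>_def \<beta>_def)
      then show "q \<in> ?R" by blast
    qed (use zt in \<open>auto simp: \<alpha>_def \<beta>_def\<close>)
    show ?thesis unfolding mu.simps zt fst_conv snd_conv im image_image by simp
  qed
  ultimately show ?case by (rule continuous_map_eq)
qed

lemma continuous_map_mu_length:
  assumes ev: "continuous_map (prod_topology Z (top_of_set {0..1})) mtopology (\<lambda>p. \<xi> (fst p) (snd p))"
  shows "continuous_map (prod_topology Z (top_of_set {0..1})) euclideanreal (\<lambda>p. mu_length d (\<xi> (fst p)) (snd p))"
proof -
  let ?P = "prod_topology Z (top_of_set {0..1::real})"
  let ?f = "\<lambda>n p. mu d (Suc n) (\<xi> (fst p)) (snd p) * (1/2) ^ Suc n"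
  have lim: "uniform_limit (topspace ?P) (\<lambda>N p. \<Sum>n<N. ?f n p) (\<lambda>p. suminf (\<lambda>n. ?f n p)) sequentially"
  proof (rule Weierstrass_m_test)
    show "summable (\<lambda>n. (1/2) ^ Suc n :: real)" using power_half_series by (simp add: sums_iff)
  qed (auto simp: mu_range abs_mult mult_left_le_one_le)
  have cont: "continuous_map ?P euclideanreal (\<lambda>p. \<Sum>n<N. ?f n p)" for N
    by (intro continuous_map_sum continuous_map_real_mult_right continuous_map_mu [OF ev]) auto
  have "continuous_map ?P Met_TC.mtopology (\<lambda>p. suminf (\<lambda>n. ?f n p))"
    by (rule Met_TC.continuous_map_uniform_limit [where F = sequentially and f = "\<lambda>N p. \<Sum>n<N. ?f n p"])
      (use cont uniform_limitD [OF lim] in auto)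
  then show ?thesis by (simp add: mu_length_def)
qed

end

section \<open>Path spaces and traces\<close>

abbreviation unit_interval :: "real topology" where
  "unit_interval \<equiv> top_of_set {0..1}"

section \<open>Evaluation and currying for the compact-open topology\<close>

lemma openin_compact_open_subbasic:
  "\<lbrakk>K \<subseteq> {0..1}; compact K; openin Y U\<rbrakk> \<Longrightarrow> openin (compact_open Y) {x \<in> paths Y. x ` K \<subseteq> U}"
  unfolding compact_open_def openin_topology_generated_by_iff
  by (rule generate_topology_on.Basis) blast

lemma path_in_topspace: "\<lbrakk>x \<in> paths Y; t \<in> {0..1}\<rbrakk> \<Longrightarrow> x t \<in> topspace Y"
  by (auto simp: paths_def pathin_def continuous_map_def)

lemma continuous_map_compact_open_eval:
  "continuous_map (prod_topology (compact_open Y) unit_interval) Y (\<lambda>p. fst p (snd p))"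
  unfolding continuous_map_def
proof (intro conjI allI impI)
  show "(\<lambda>p. fst p (snd p)) \<in> topspace (prod_topology (compact_open Y) unit_interval) \<rightarrow> topspace Y"
    by (auto simp: path_in_topspace)
  fix U assume U: "openin Y U"
  let ?W = "{p \<in> topspace (prod_topology (compact_open Y) unit_interval). fst p (snd p) \<in> U}"
  have *: "\<exists>T. openin (prod_topology (compact_open Y) unit_interval) T \<and> p \<in> T \<and> T \<subseteq> ?W" if p: "p \<in> ?W" for p
  proof -
    obtain x t where xt: "p = (x, t)" "x \<in> paths Y" "t \<in> {0..1}" "x t \<in> U" using p by auto
    then have "openin unit_interval {s \<in> {0..1}. x s \<in> U}"
      using openin_continuous_map_preimage [of unit_interval Y x U] U by (auto simp: paths_def pathin_def)
    then have "\<exists>e>0. \<forall>s\<in>{0..1}. dist s t < e \<longrightarrow> s \<in> {s \<in> {0..1}. x s \<in> U}"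
      using xt(3,4) unfolding openin_euclidean_subtopology_iff by blast
    then obtain e where e: "e > 0" "\<And>s. \<lbrakk>s \<in> {0..1}; dist s t < e\<rbrakk> \<Longrightarrow> x s \<in> U"
      by blast
    \<comment> \<open>Halving the radius gives a compact neighbourhood of t that \<open>x\<close>
      still maps into U: its closed form defines the subbasic set of paths, its open form the
      neighbourhood of times.\<close>
    let ?K = "{0..1} \<inter> cball t (e/2)"
    let ?V = "{y \<in> paths Y. y ` ?K \<subseteq> U}"
    have "openin (compact_open Y) ?V"
      by (rule openin_compact_open_subbasic [OF _ _ U]) (auto intro: compact_Int)
    moreover have "openin unit_interval ({0..1} \<inter> ball t (e/2))"
      by (simp add: openin_open_Int)
    ultimately have "openin (prod_topology (compact_open Y) unit_interval) (?V \<times> ({0..1} \<inter> ball t (e/2)))"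
      by (simp add: openin_prod_Times_iff)
    moreover have "x ` ?K \<subseteq> U" using e by (auto simp: dist_commute)
    moreover have "?V \<times> ({0..1} \<inter> ball t (e/2)) \<subseteq> ?W" by auto
    ultimately show ?thesis
      using xt e(1) by (intro exI [of _ "?V \<times> ({0..1} \<inter> ball t (e/2))"]) auto
  qed
  show "openin (prod_topology (compact_open Y) unit_interval) ?W"
    unfolding openin_subopen [of _ ?W] using * by blast
qed

text \<open>The parameters whose path leaves U at some time in K form the projection of a closed set
  along the compact factor K, hence a closed set.\<close>

lemma continuous_map_into_compact_open:
  assumes F: "continuous_map (prod_topology B unit_interval) Y F"
  shows "continuous_map B (compact_open Y) (\<lambda>b. \<lambda>t\<in>{0..1}. F (b, t))"
proof -
  let ?f = "\<lambda>b. \<lambda>t\<in>{0..1}. F (b, t)"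
  have path: "?f b \<in> paths Y" if "b \<in> topspace B" for b
  proof -
    have "continuous_map unit_interval Y (F \<circ> (\<lambda>t. (b, t)))"
      by (rule continuous_map_compose [OF _ F]) (use that in \<open>simp add: continuous_map_paired\<close>)
    then have "continuous_map unit_interval Y (?f b)"
      by (rule continuous_map_eq) auto
    then show ?thesis by (simp add: paths_def pathin_def)
  qed
  show ?thesis
    unfolding compact_open_def continuous_on_generated_topo_iff
  proof (intro conjI allI impI)
    fix W assume "W \<in> {{x \<in> paths Y. x ` K \<subseteq> U} |K U. K \<subseteq> {0..1} \<and> compact K \<and> openin Y U}"
    then obtain K U where KU: "W = {x \<in> paths Y. x ` K \<subseteq> U}" "K \<subseteq> {0..1}" "compact K" "openin Y U"
      by blast
    have cK: "compact_space (top_of_set K)" using KU(3) by (simp add: compact_space_subtopology)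
    have "continuous_map (prod_topology B (top_of_set K)) (prod_topology B unit_interval) (\<lambda>p. (fst p, snd p))"
      using KU(2) by (intro continuous_map_pairedI continuous_map_fst continuous_map_into_subtopology
          continuous_map_into_fulltopology [OF continuous_map_snd]) auto
    from continuous_map_compose [OF this F] have "continuous_map (prod_topology B (top_of_set K)) Y F"
      by (simp add: o_def)
    then have "closedin (prod_topology B (top_of_set K))
        {p \<in> topspace (prod_topology B (top_of_set K)). F p \<in> topspace Y - U}"
      by (rule closedin_continuous_map_preimage) (use KU(4) in blast)
    then have "closedin B (fst ` {p \<in> topspace (prod_topology B (top_of_set K)). F p \<in> topspace Y - U})"
      using closed_map_fst [OF cK] closed_map_def by blast
    moreover have "?f -` W \<inter> topspace B
        = topspace B - fst ` {p \<in> topspace (prod_topology B (top_of_set K)). F p \<in> topspace Y - U}"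
    proof (intro equalityI subsetI)
      fix b assume "b \<in> ?f -` W \<inter> topspace B"
      then have "b \<in> topspace B" "\<And>t. t \<in> K \<Longrightarrow> ?f b t \<in> U"
        using KU(1) by (auto simp del: restrict_apply)
      moreover from this have "F (b, t) \<in> U" if "t \<in> K" for t
        using that KU(2) by (metis restrict_apply subsetD)
      ultimately show "b \<in> topspace B - fst ` {p \<in> topspace (prod_topology B (top_of_set K)). F p \<in> topspace Y - U}"
        by auto
    next
      fix b assume b: "b \<in> topspace B - fst ` {p \<in> topspace (prod_topology B (top_of_set K)). F p \<in> topspace Y - U}"
      have "F (b, t) \<in> U" if "t \<in> K" for t
      proof -
        have "?f b t \<in> topspace Y" using path [of b] b that KU(2) path_in_topspace by blast
        then have "F (b, t) \<in> topspace Y" using that KU(2) by auto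
        then show ?thesis using b that by force
      qed
      then show "b \<in> ?f -` W \<inter> topspace B" using path [of b] b KU(1,2) by auto
    qed
    ultimately show "openin B (?f -` W \<inter> topspace B)" by auto
  next
    have "\<Union> {{x \<in> paths Y. x ` K \<subseteq> U} |K U. K \<subseteq> {0..1} \<and> compact K \<and> openin Y U} = paths Y"
      using topspace_compact_open [of Y] unfolding compact_open_def topology_generated_by_topspace .
    then show "?f ` topspace B \<subseteq> \<Union> {{x \<in> paths Y. x ` K \<subseteq> U} |K U. K \<subseteq> {0..1} \<and> compact K \<and> openin Y U}"
      using path by auto
  qed
qed

lemma Hausdorff_space_compact_open:
  assumes Y: "Hausdorff_space Y" shows "Hausdorff_space (compact_open Y)"
  unfolding Hausdorff_space_def topspace_compact_open
proof (intro allI impI, elim conjE)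
  fix x y assume x: "x \<in> paths Y" and y: "y \<in> paths Y" and "x \<noteq> y"
  then obtain t where t: "t \<in> {0..1}" "x t \<noteq> y t"
    using extensionalityI [of x "{0..1}" y] by (auto simp: paths_def)
  then obtain U V where UV: "openin Y U" "openin Y V" "x t \<in> U" "y t \<in> V" "disjnt U V"
    using Y x y path_in_topspace unfolding Hausdorff_space_def by metis
  let ?S = "\<lambda>U. {x \<in> paths Y. x ` {t} \<subseteq> U}"
  have "openin (compact_open Y) (?S U)" "openin (compact_open Y) (?S V)"
    by (rule openin_compact_open_subbasic; use t UV in simp)+
  moreover have "disjnt (?S U) (?S V)" using UV(5) by (auto simp: disjnt_def)
  ultimately show "\<exists>U V. openin (compact_open Y) U \<and> openin (compact_open Y) V \<and> x \<in> U \<and> y \<in> V \<and> disjnt U V"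
    using x y UV by (intro exI [of _ "?S U"] exI [of _ "?S V"]) auto
qed

section \<open>Trace equivalence and the images of traces\<close>

lemma trace_class_eq_iff: "trace_class X x = trace_class X y \<longleftrightarrow> trace_equiv X x y"
  unfolding trace_class_def trace_equiv_def
  by (metis (no_types, lifting) equivclp_refl equivclp_sym equivclp_trans mem_Collect_eq Collect_cong)

lemma trace_equiv_reparam: "\<lbrakk>x \<in> dpaths X; \<phi> \<in> Rep\<rbrakk> \<Longrightarrow> trace_equiv X x (reparam x \<phi>)"
  unfolding trace_equiv_def by (rule r_into_equivclp) auto

lemma reparam_image: "\<phi> \<in> Rep \<Longrightarrow> reparam x \<phi> ` {0..1} = x ` {0..1}"
  unfolding reparam_def Rep_def by (auto simp: image_image [symmetric])

lemma topspace_trace_space: "topspace (trace_space X u v) = trace_class X ` topspace (path_space X u v)"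
  using quotient_map_quotient_topology quotient_imp_surjective_map unfolding trace_space_def by metis

lemma quotient_map_trace_class: "quotient_map (path_space X u v) (trace_space X u v) (trace_class X)"
  unfolding trace_space_def by (rule quotient_map_quotient_topology)

locale directed =
  fixes C :: Top_choice and X :: "'a dspace"
  assumes dir: "directed_space C X"
begin

lemma dpaths_paths: "x \<in> dpaths X \<Longrightarrow> x \<in> paths (underlying X)"
  using dir by (auto simp: directed_space_def)

lemma topspace_path_space [simp]: "topspace (path_space X u v) = dpaths_between X u v"
  by (auto simp: path_space_def dpaths_between_def dpaths_paths)

lemma reparam_dpaths: "\<lbrakk>x \<in> dpaths X; \<phi> \<in> Rep\<rbrakk> \<Longrightarrow> reparam x \<phi> \<in> dpaths X"
  using dir by (auto simp: directed_space_def Rep_def Mon_def)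

lemma reparam_dpaths_between:
  assumes "x \<in> dpaths_between X u v" "\<phi> \<in> Rep"
  shows "reparam x \<phi> \<in> dpaths_between X u v"
  using assms reparam_dpaths Rep_endpoints [of \<phi>]
  by (simp add: dpaths_between_def) (simp add: reparam_def)

text \<open>A zigzag of reparametrizations never leaves the directed paths from u to v: the
  generating relation demands a directed source, and elements of \<open>Rep\<close> fix 0 and 1, so
  endpoints survive steps in both directions.\<close>

lemma trace_equiv_induct [consumes 2, case_names refl reparam unreparam]:
  assumes "trace_equiv X x y" "x \<in> dpaths_between X u v"
    and "P x"
    and "\<And>y \<phi>. \<lbrakk>y \<in> dpaths_between X u v; P y; \<phi> \<in> Rep\<rbrakk> \<Longrightarrow> P (reparam y \<phi>)"
    and "\<And>y \<phi>. \<lbrakk>y \<in> dpaths_between X u v; P (reparam y \<phi>); \<phi> \<in> Rep\<rbrakk> \<Longrightarrow> P y"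
  shows "P y \<and> y \<in> dpaths_between X u v"
  using assms(1) unfolding trace_equiv_def
proof (induction rule: equivclp_induct)
  case base
  then show ?case using assms by simp
next
  case (step y z)
  from step(2) show ?case
  proof
    assume "y \<in> dpaths X \<and> (\<exists>\<phi>\<in>Rep. z = reparam y \<phi>)"
    then show ?thesis using step(3) assms(4) reparam_dpaths_between by blast
  next
    assume "z \<in> dpaths X \<and> (\<exists>\<phi>\<in>Rep. y = reparam z \<phi>)"
    then obtain \<phi> where \<phi>: "z \<in> dpaths X" "\<phi> \<in> Rep" "y = reparam z \<phi>" by blast
    then have "z \<in> dpaths_between X u v"
      using step(3) Rep_endpoints [OF \<phi>(2)] by (simp add: dpaths_between_def reparam_def)
    then show ?thesis using step(3) assms(5) \<phi> by blast
  qed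
qed

lemma trace_equiv_dpaths_between:
  assumes "trace_equiv X x y" "x \<in> dpaths_between X u v"
  shows "y \<in> dpaths_between X u v" "y ` {0..1} = x ` {0..1}"
proof -
  have "y ` {0..1} = x ` {0..1} \<and> y \<in> dpaths_between X u v"
    using assms by (induction rule: trace_equiv_induct) (simp_all add: reparam_image)
  then show "y \<in> dpaths_between X u v" "y ` {0..1} = x ` {0..1}" by auto
qed

lemma continuous_map_path_space_compact_open:
  "continuous_map (path_space X u v) (compact_open (underlying X)) id"
  using continuous_map_into_fulltopology [OF continuous_map_k_Delta_id] unfolding path_space_def .

lemma continuous_map_path_space_eval:
  "continuous_map (prod_topology (path_space X u v) unit_interval) (underlying X) (\<lambda>p. fst p (snd p))"
proof -
  have "continuous_map (prod_topology (path_space X u v) unit_interval)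
      (prod_topology (compact_open (underlying X)) unit_interval) (\<lambda>p. (id (fst p), snd p))"
    by (intro continuous_map_pairedI continuous_map_snd
        continuous_map_compose [OF continuous_map_fst continuous_map_path_space_compact_open, unfolded o_def])
  from continuous_map_compose [OF this continuous_map_compact_open_eval] show ?thesis
    by (simp add: o_def)
qed

lemma openin_path_space_image_subset:
  assumes "openin (underlying X) U"
  shows "openin (path_space X u v) {x \<in> dpaths_between X u v. x ` {0..1} \<subseteq> U}"
proof -
  have "openin (compact_open (underlying X)) {x \<in> paths (underlying X). x ` {0..1} \<subseteq> U}"
    by (rule openin_compact_open_subbasic) (use assms in auto)
  from openin_continuous_map_preimage [OF continuous_map_path_space_compact_open this]
  have "openin (path_space X u v) {x \<in> dpaths_between X u v. x \<in> paths (underlying X) \<and> x ` {0..1} \<subseteq> U}"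
    by simp
  moreover have "{x \<in> dpaths_between X u v. x \<in> paths (underlying X) \<and> x ` {0..1} \<subseteq> U}
      = {x \<in> dpaths_between X u v. x ` {0..1} \<subseteq> U}"
    using dpaths_paths by (auto simp: dpaths_between_def)
  ultimately show ?thesis by metis
qed

lemma closedin_path_space_image_subset:
  assumes K: "closedin (underlying X) K"
  shows "closedin (path_space X u v) {x \<in> dpaths_between X u v. x ` {0..1} \<subseteq> K}"
proof -
  have eval: "continuous_map (path_space X u v) (underlying X) (\<lambda>x. x t)" if "t \<in> {0..1}" for t
  proof -
    have "continuous_map (path_space X u v) (prod_topology (path_space X u v) unit_interval) (\<lambda>x. (x, t))"
      using that by (simp add: continuous_map_paired flip: id_def)
    from continuous_map_compose [OF this continuous_map_path_space_eval] show ?thesis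
      by (simp add: o_def)
  qed
  have "closedin (path_space X u v) (\<Inter>t\<in>{0..1}. {x \<in> topspace (path_space X u v). x t \<in> K})"
    by (intro closedin_INT closedin_continuous_map_preimage [OF eval K]) auto
  moreover have "(\<Inter>t\<in>{0..1::real}. {x \<in> topspace (path_space X u v). x t \<in> K})
      = {x \<in> dpaths_between X u v. x ` {0..1} \<subseteq> K}"
    (is "?L = ?R")
  proof (intro equalityI subsetI)
    fix x assume x: "x \<in> ?L"
    then have "x \<in> dpaths_between X u v" by (auto dest: bspec [where x = 0])
    with x show "x \<in> ?R" by auto
  qed auto
  ultimately show ?thesis by simp
qed

text \<open>All representatives of a trace have the same image. The images \<open>im b\<close> are
  compact and depend upper semicontinuously on b, so finite subcovers for single images extend to
  neighbourhoods in B, finitely many of which cover B.\<close>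

lemma compactin_union_of_traces:
  assumes B: "compact_space B" and h: "continuous_map B (trace_space X u v) h"
  obtains K where "compactin (underlying X) K"
    "\<And>b x. \<lbrakk>b \<in> topspace B; x \<in> dpaths_between X u v; trace_class X x = h b\<rbrakk> \<Longrightarrow> x ` {0..1} \<subseteq> K"
proof -
  let ?X = "underlying X"
  define im where "im b = (\<Union>{x ` {0..1} |x. x \<in> dpaths_between X u v \<and> trace_class X x = h b})" for b
  have im: "im b = x ` {0..1}" if "x \<in> dpaths_between X u v" "trace_class X x = h b" for b x
  proof -
    have "y ` {0..1} = x ` {0..1}" if "y \<in> dpaths_between X u v" "trace_class X y = h b" for y
      using trace_equiv_dpaths_between(2) [of y x u v] that \<open>trace_class X x = h b\<close> trace_class_eq_iff [of X y x]
      by simp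
    then show ?thesis unfolding im_def using that by blast
  qed
  have ex: "\<exists>x. x \<in> dpaths_between X u v \<and> trace_class X x = h b" if "b \<in> topspace B" for b
    using h that unfolding continuous_map_def topspace_trace_space by fastforce
  have op: "openin B {b \<in> topspace B. im b \<subseteq> U}" if U: "openin ?X U" for U
  proof -
    \<comment> \<open>Paths with image in U form an open set that is a union of trace classes, so
      its image is open in the quotient.\<close>
    let ?O = "trace_class X ` {x \<in> dpaths_between X u v. x ` {0..1} \<subseteq> U}"
    have "{x \<in> dpaths_between X u v. trace_class X x \<in> ?O} = {x \<in> dpaths_between X u v. x ` {0..1} \<subseteq> U}"
      using trace_equiv_dpaths_between(2) by (fastforce simp: trace_class_eq_iff)
    then have "openin (trace_space X u v) ?O"
      unfolding trace_space_def openin_quotient_topology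
      using openin_path_space_image_subset [OF U, of u v] by auto
    from openin_continuous_map_preimage [OF h this]
    have "openin B {b \<in> topspace B. h b \<in> ?O}" .
    moreover have "h b \<in> ?O \<longleftrightarrow> im b \<subseteq> U" if b: "b \<in> topspace B" for b
    proof -
      obtain x where x: "x \<in> dpaths_between X u v" "trace_class X x = h b" using ex [OF b] by blast
      show ?thesis
      proof
        assume "h b \<in> ?O"
        then show "im b \<subseteq> U" using im by force
      next
        assume "im b \<subseteq> U"
        then show "h b \<in> ?O" using x im [OF x] by (metis (mono_tags, lifting) image_eqI mem_Collect_eq)
      qed
    qed
    ultimately show ?thesis by (metis (mono_tags, lifting) Collect_cong)
  qed
  have "compactin ?X (im b)" if "b \<in> topspace B" for b
  proof -
    obtain x where x: "x \<in> dpaths_between X u v" "trace_class X x = h b" using ex [OF \<open>b \<in> topspace B\<close>] by blast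
    then have "pathin ?X x" using dpaths_paths by (auto simp: dpaths_between_def paths_def)
    then show ?thesis using im [OF x] compactin_path_image by metis
  qed
  note cim = this
  have "compactin ?X (\<Union>b\<in>topspace B. im b)"
    unfolding compactin_def
  proof (intro conjI allI impI)
    show "(\<Union>b\<in>topspace B. im b) \<subseteq> topspace ?X" using cim compactin_subset_topspace by blast
    fix \<U> assume \<U>: "(\<forall>U\<in>\<U>. openin ?X U) \<and> (\<Union>b\<in>topspace B. im b) \<subseteq> \<Union> \<U>"
    have "\<exists>\<F>. finite \<F> \<and> \<F> \<subseteq> \<U> \<and> im b \<subseteq> \<Union> \<F>" if "b \<in> topspace B" for b
      by (rule compactinD [OF cim [OF that]]) (use \<U> that in blast)+
    then obtain \<F> where \<F>: "\<And>b. b \<in> topspace B \<Longrightarrow> finite (\<F> b) \<and> \<F> b \<subseteq> \<U> \<and> im b \<subseteq> \<Union> (\<F> b)"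
      by metis
    let ?W = "\<lambda>b. {b' \<in> topspace B. im b' \<subseteq> \<Union> (\<F> b)}"
    have "openin B (?W b)" if "b \<in> topspace B" for b
      by (rule op [OF openin_Union]) (meson \<F> [OF that] \<U> subsetD)
    moreover have "topspace B \<subseteq> \<Union> (?W ` topspace B)" using \<F> by blast
    ultimately obtain \<W> where \<W>: "finite \<W>" "\<W> \<subseteq> ?W ` topspace B" "topspace B \<subseteq> \<Union> \<W>"
      using compactinD [of B "topspace B" "?W ` topspace B"] B unfolding compact_space_def
      by (metis (no_types, lifting) imageE)
    obtain D where "D \<subseteq> topspace B" "finite D" "\<W> = ?W ` D"
      using finite_subset_image [OF \<W>(1,2)] by blast
    with \<W>(3) have D: "finite D" "D \<subseteq> topspace B" "topspace B \<subseteq> \<Union> (?W ` D)"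
      by simp_all
    have "finite (\<F> b)" "\<F> b \<subseteq> \<U>" if "b \<in> D" for b using \<F> D(2) that by blast+
    then have "finite (\<Union> (\<F> ` D))" "\<Union> (\<F> ` D) \<subseteq> \<U>" using D(1) by (blast, blast)
    moreover have "im b \<subseteq> \<Union> (\<Union> (\<F> ` D))" if "b \<in> topspace B" for b
    proof -
      have "b \<in> \<Union> (?W ` D)" using D(3) that by (rule subsetD)
      then show ?thesis by blast
    qed
    then have "(\<Union>b\<in>topspace B. im b) \<subseteq> \<Union> (\<Union> (\<F> ` D))" by blast
    ultimately show "\<exists>\<F>. finite \<F> \<and> \<F> \<subseteq> \<U> \<and> (\<Union>b\<in>topspace B. im b) \<subseteq> \<Union> \<F>" by blast
  qed
  then show thesis by (rule that) (use im in blast)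
qed

end

section \<open>Traces in a metrizable set\<close>

text \<open>The swept-out compact set enters through two consequences: it is closed in X, so the
  traces inside it form a closed subspace, and its subspace topology has a metric.\<close>

locale metrizable_traces = directed C X + Metric_space K d
  for C and X :: "'a dspace" and K :: "'a set" and d +
  fixes u v :: 'a
  assumes sat: "saturated X"
    and haus: "Hausdorff_space (underlying X)"
    and closed: "closedin (underlying X) K"
    and metric: "subtopology (underlying X) K = mtopology"
begin

abbreviation len :: "(real \<Rightarrow> 'a) \<Rightarrow> real \<Rightarrow> real" where
  "len \<equiv> mu_length d"

definition paths_in :: "(real \<Rightarrow> 'a) set" where
  "paths_in = {x \<in> dpaths_between X u v. x ` {0..1} \<subseteq> K}"

definition path_subspace :: "(real \<Rightarrow> 'a) topology" where
  "path_subspace = subtopology (path_space X u v) paths_in"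

definition trace_subspace :: "(real \<Rightarrow> 'a) set topology" where
  "trace_subspace = subtopology (trace_space X u v) (trace_class X ` paths_in)"

lemma paths_in_subset: "paths_in \<subseteq> dpaths_between X u v"
  by (auto simp: paths_in_def)

lemma topspace_path_subspace [simp]: "topspace path_subspace = paths_in"
  using paths_in_subset by (auto simp: path_subspace_def)

lemma topspace_trace_subspace [simp]: "topspace trace_subspace = trace_class X ` paths_in"
  using paths_in_subset by (auto simp: trace_subspace_def topspace_trace_space)

lemma paths_in_pathin: "x \<in> paths_in \<Longrightarrow> pathin mtopology x"
  using dpaths_paths [of x]
  by (auto simp: paths_in_def dpaths_between_def paths_def pathin_subtopology simp flip: metric)

lemma paths_in_K: "\<lbrakk>x \<in> paths_in; t \<in> {0..1}\<rbrakk> \<Longrightarrow> x t \<in> K"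
  by (auto simp: paths_in_def)

lemma paths_in_extensional: "x \<in> paths_in \<Longrightarrow> x \<in> extensional {0..1}"
  using dpaths_paths [of x] by (auto simp: paths_in_def dpaths_between_def paths_def)

lemma trace_equiv_paths_in: "\<lbrakk>x \<in> paths_in; trace_equiv X x y\<rbrakk> \<Longrightarrow> y \<in> paths_in"
  unfolding paths_in_def using trace_equiv_dpaths_between [of x y u v] by auto

text \<open>Reparametrization preserves the image of a path, so \<open>paths_in\<close> is a union
  of trace classes.\<close>

lemma trace_class_preimage:
  "{x \<in> topspace (path_space X u v). trace_class X x \<in> trace_class X ` paths_in} = paths_in"
proof (intro equalityI subsetI)
  fix x assume "x \<in> {x \<in> topspace (path_space X u v). trace_class X x \<in> trace_class X ` paths_in}"
  then obtain y where "y \<in> paths_in" "trace_class X y = trace_class X x" by auto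
  then show "x \<in> paths_in" using trace_equiv_paths_in by (simp add: trace_class_eq_iff)
qed (use paths_in_subset in auto)

lemma closedin_traces_in: "closedin (trace_space X u v) (trace_class X ` paths_in)"
proof -
  have "closedin (path_space X u v) paths_in"
    unfolding paths_in_def by (rule closedin_path_space_image_subset [OF closed])
  moreover have "trace_class X ` paths_in \<subseteq> topspace (trace_space X u v)"
    using paths_in_subset by (auto simp: topspace_trace_space)
  ultimately show ?thesis
    using quotient_map_trace_class [of X u v, unfolded quotient_map_closedin, THEN conjunct2,
        rule_format, of "trace_class X ` paths_in"]
    by (simp only: trace_class_preimage)
qed

text \<open>A quotient map restricts to the full preimage of a closed set; closedness of K is what
  provides such a set.\<close>

lemma quotient_map_subspaces: "quotient_map path_subspace trace_subspace (trace_class X)"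
  unfolding path_subspace_def trace_subspace_def
  by (rule quotient_map_restriction [OF quotient_map_trace_class trace_class_preimage])
    (use closedin_traces_in in blast)

lemma continuous_map_path_subspace_eval:
  "continuous_map (prod_topology path_subspace unit_interval) mtopology (\<lambda>p. fst p (snd p))"
proof -
  have "continuous_map (prod_topology path_subspace unit_interval) (prod_topology (path_space X u v) unit_interval)
      (\<lambda>p. (fst p, snd p))"
    unfolding path_subspace_def
    by (intro continuous_map_pairedI continuous_map_snd continuous_map_into_fulltopology [OF continuous_map_fst])
  from continuous_map_compose [OF this continuous_map_path_space_eval]
  show ?thesis
    unfolding metric [symmetric]
    by (intro continuous_map_into_subtopology) (auto simp: o_def paths_in_K)
qed

lemma continuous_map_len:
  "continuous_map (prod_topology path_subspace unit_interval) euclideanreal (\<lambda>p. len (fst p) (snd p))"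
  by (rule continuous_map_mu_length [OF continuous_map_path_subspace_eval])

lemma continuous_on_len:
  assumes "x \<in> paths_in" shows "continuous_on {0..1} (len x)"
proof -
  have "continuous_map unit_interval (prod_topology path_subspace unit_interval) (\<lambda>t. (x, t))"
    using assms by (simp add: continuous_map_paired flip: id_def)
  from continuous_map_compose [OF this continuous_map_len] show ?thesis by (simp add: o_def)
qed

lemma len_0: "x \<in> paths_in \<Longrightarrow> len x 0 = 0"
  by (simp add: mu_length_0 paths_in_K)

lemma len_range:
  assumes "x \<in> paths_in" "t \<in> {0..1}" shows "0 \<le> len x t" "len x t \<le> len x 1" "len x t \<le> 1"
  using assms mu_length_mono [of 0 t x] mu_length_mono [of t 1 x] mu_length_le_1 [of t x] len_0 by auto

lemma len_surj:
  assumes "x \<in> paths_in" "0 \<le> s" "s \<le> len x 1"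
  obtains t where "t \<in> {0..1}" "len x t = s"
  using IVT' [of "len x" 0 s 1] assms continuous_on_len len_0 by auto

lemma len_eq_imp:
  assumes "x \<in> paths_in" "s \<in> {0..1}" "t \<in> {0..1}" "len x s = len x t"
  shows "x s = x t"
proof (cases "s \<le> t")
  case True
  then show ?thesis using mu_length_eq_imp [OF paths_in_pathin, of x s t] assms by auto
next
  case False
  then show ?thesis using mu_length_eq_imp [OF paths_in_pathin, of x t s] assms by auto
qed

text \<open>The factor of \<open>y\<close> through the \<open>\<mu>\<close>-length parametrization \<open>r\<close> of \<open>x\<close> is a reparametrization;
  saturation makes \<open>r\<close> directed. If \<open>x\<close> is constant, \<open>r\<close> does not exist and \<open>y = x\<close>.\<close>

lemma trace_equiv_of_len_factor:
  assumes x: "x \<in> paths_in" and y: "y \<in> extensional {0..1}"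
    and N: "continuous_on {0..1} N" "mono_on {0..1} N" "N 0 = 0" "N 1 = len x 1"
    and xy: "\<And>t t'. \<lbrakk>t \<in> {0..1}; t' \<in> {0..1}; len x t = N t'\<rbrakk> \<Longrightarrow> y t' = x t"
  shows "trace_equiv X x y"
proof -
  define l where "l = len x 1"
  have N_range: "0 \<le> N t" "N t \<le> l" if "t \<in> {0..1}" for t
    using that mono_onD [OF N(2), of 0 t] mono_onD [OF N(2), of t 1] N(3,4) by (auto simp: l_def)
  have "0 \<le> l" using len_range [OF x, of 1] by (simp add: l_def)
  show ?thesis
  proof (cases "l = 0")
    case True
    have "y t = x t" if t: "t \<in> {0..1}" for t
      using xy [OF t t] N_range [OF t] len_range [OF x t] True by (simp add: l_def)
    then have "y = x" using extensionalityI [OF y paths_in_extensional [OF x]] by blast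
    then show ?thesis by (simp add: trace_equiv_def)
  next
    case False
    then have l: "l > 0" using \<open>0 \<le> l\<close> by simp
    define \<phi> where "\<phi> t = len x t / l" for t
    define \<psi> where "\<psi> t = N t / l" for t
    have \<phi>: "\<phi> \<in> Rep"
    proof (rule RepI)
      show "continuous_on {0..1} \<phi>" unfolding \<phi>_def using l continuous_on_len [OF x]
        by (intro continuous_intros) auto
      show "mono_on {0..1} \<phi>" unfolding \<phi>_def using l
        by (intro mono_onI divide_right_mono mu_length_mono) auto
    qed (use l x in \<open>auto simp: \<phi>_def len_0 l_def\<close>)
    have \<psi>: "\<psi> \<in> Rep"
    proof (rule RepI)
      show "continuous_on {0..1} \<psi>" unfolding \<psi>_def using l N(1) by (intro continuous_intros) auto
      show "mono_on {0..1} \<psi>" unfolding \<psi>_def using l N(2)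
        by (intro mono_onI divide_right_mono mono_onD [OF N(2)]) auto
    qed (use l N in \<open>auto simp: \<psi>_def l_def\<close>)
    \<comment> \<open>The chosen time is immaterial: \<open>x\<close> is constant between times of
      equal length.\<close>
    define r where "r = (\<lambda>s\<in>{0..1}. x (SOME t. t \<in> {0..1} \<and> len x t = l * s))"
    have r: "r (len x t / l) = x t" if t: "t \<in> {0..1}" for t
    proof -
      let ?t = "SOME t'. t' \<in> {0..1} \<and> len x t' = l * (len x t / l)"
      have "?t \<in> {0..1} \<and> len x ?t = l * (len x t / l)"
        by (rule someI [of _ t]) (use t l in auto)
      then have "x ?t = x t" using len_eq_imp [OF x, of ?t t] t l by simp
      moreover have "len x t / l \<in> {0..1}" using len_range [OF x t] l by (simp add: l_def)
      ultimately show ?thesis unfolding r_def by simp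
    qed
    have "reparam r \<phi> = x"
      by (rule extensionalityI [OF _ paths_in_extensional [OF x]]) (auto simp: reparam_def \<phi>_def r)
    have "reparam r \<psi> = y"
    proof (rule extensionalityI [OF _ y])
      fix t' :: real assume t': "t' \<in> {0..1}"
      obtain t where t: "t \<in> {0..1}" "len x t = N t'"
        using len_surj [OF x] N_range [OF t'] unfolding l_def by metis
      then show "reparam r \<psi> t' = y t'"
        using r [OF t(1)] xy [OF t(1) t' t(2)] t' by (simp add: reparam_def \<psi>_def)
    qed (simp add: reparam_def)
    \<comment> \<open>Since \<open>r\<close> is built by choice, its continuity is obtained
      indirectly: \<phi> is a quotient map of the compact Hausdorff interval, and \<open>r\<close>
      composed with \<phi> is the path \<open>x\<close>.\<close>
    have "r \<in> paths (underlying X)"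
    proof -
      have "continuous_map unit_interval unit_interval \<phi>" "\<phi> ` {0..1} = {0..1}"
        using \<phi> by (auto simp: Rep_def)
      then have "quotient_map unit_interval unit_interval \<phi>"
        by (intro T1_Spaces.continuous_imp_quotient_map) (auto simp: compact_space_subtopology Hausdorff_space_subtopology)
      moreover have "continuous_map unit_interval (underlying X) (r \<circ> \<phi>)"
      proof (rule continuous_map_eq)
        show "continuous_map unit_interval (underlying X) x"
          using x dpaths_paths by (auto simp: paths_in_def dpaths_between_def paths_def pathin_def)
      qed (simp add: \<phi>_def r)
      ultimately show ?thesis
        using continuous_compose_quotient_map [of unit_interval unit_interval \<phi> "underlying X" r]
      by (simp add: paths_def pathin_def) (simp add: r_def)
    qed
    moreover have "x \<in> dpaths X" using x by (auto simp: paths_in_def dpaths_between_def)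
    ultimately have "r \<in> dpaths X"
      using sat \<phi> \<open>reparam r \<phi> = x\<close> unfolding saturated_def by metis
    then have "trace_equiv X r x" "trace_equiv X r y"
      using trace_equiv_reparam \<phi> \<psi> \<open>reparam r \<phi> = x\<close> \<open>reparam r \<psi> = y\<close> by metis+
    then show ?thesis by (metis trace_class_eq_iff)
  qed
qed

text \<open>Equality of the \<open>\<mu>\<close>-length parametrizations of \<open>x\<close> and \<open>y\<close>.\<close>

definition same_graph :: "(real \<Rightarrow> 'a) \<Rightarrow> (real \<Rightarrow> 'a) \<Rightarrow> bool" where
  "same_graph x y \<longleftrightarrow> len x 1 = len y 1 \<and>
     (\<forall>s\<in>{0..1}. \<forall>t\<in>{0..1}. len x s = len y t \<longrightarrow> x s = y t)"

lemma same_graph_sym: "same_graph x y \<Longrightarrow> same_graph y x"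
  unfolding same_graph_def by metis

text \<open>The middle path attains every intermediate length, which supplies a time at which to
  compare the outer two.\<close>

lemma same_graph_trans:
  assumes y: "y \<in> paths_in" and x: "x \<in> paths_in" and "same_graph x y" "same_graph y z"
  shows "same_graph x z"
proof -
  have "x s = z t" if st: "s \<in> {0..1}" "t \<in> {0..1}" "len x s = len z t" for s t
  proof -
    obtain r where "r \<in> {0..1}" "len y r = len x s"
      using len_surj [OF y] len_range [OF x st(1)] \<open>same_graph x y\<close> unfolding same_graph_def by metis
    then show ?thesis using assms st unfolding same_graph_def by metis
  qed
  then show ?thesis using assms unfolding same_graph_def by metis
qed

lemma same_graph_reparam:
  assumes "x \<in> paths_in" "\<phi> \<in> Rep" shows "same_graph x (reparam x \<phi>)"
proof -
  have im: "\<phi> t \<in> {0..1}" if "t \<in> {0..1}" for t using assms that by (auto simp: Rep_def)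
  have "x s = reparam x \<phi> t" if "s \<in> {0..1}" "t \<in> {0..1}" "len x s = len (reparam x \<phi>) t" for s t
    using that len_eq_imp [OF assms(1) that(1) im [OF that(2)]] assms(2)
    by (simp add: mu_length_reparam) (simp add: reparam_def)
  then show ?thesis
    unfolding same_graph_def using assms(2) by (auto simp: mu_length_reparam Rep_endpoints)
qed

lemma same_graph_if_trace_equiv:
  assumes "trace_equiv X x y" "x \<in> paths_in" shows "same_graph x y"
proof -
  have x: "x \<in> dpaths_between X u v" using assms paths_in_subset by auto
  have "(y \<in> paths_in \<and> same_graph x y) \<and> y \<in> dpaths_between X u v"
    using assms(1) x
  proof (induction rule: trace_equiv_induct)
    case refl
    then show ?case using assms(2) len_eq_imp by (auto simp: same_graph_def)
  next
    case (reparam y \<phi>)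
    then have "reparam y \<phi> \<in> paths_in"
      using reparam_dpaths_between by (auto simp: paths_in_def reparam_image)
    with reparam show ?case
      using same_graph_trans [of y x "reparam y \<phi>"] same_graph_reparam assms(2) by blast
  next
    case (unreparam y \<phi>)
    then have "y \<in> paths_in" by (auto simp: paths_in_def reparam_image)
    with unreparam show ?case
      using same_graph_trans [of "reparam y \<phi>" x y] same_graph_reparam same_graph_sym assms(2) by blast
  qed
  then show ?thesis by blast
qed

text \<open>From right to left saturation enters, through the factor lemma with \<open>len y\<close>
  in the role of \<open>N\<close>; the other direction is induction along a zigzag.\<close>

lemma trace_class_eq_iff_same_graph:
  assumes x: "x \<in> paths_in" and y: "y \<in> paths_in"
  shows "trace_class X x = trace_class X y \<longleftrightarrow> same_graph x y"
proof
  assume s: "same_graph x y"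
  have "trace_equiv X x y"
  proof (rule trace_equiv_of_len_factor [OF x paths_in_extensional [OF y] continuous_on_len [OF y]])
    show "mono_on {0..1} (len y)" by (intro mono_onI mu_length_mono) auto
  qed (use s y in \<open>auto simp: same_graph_def len_0\<close>)
  then show "trace_class X x = trace_class X y" by (simp add: trace_class_eq_iff)
qed (use assms same_graph_if_trace_equiv in \<open>simp add: trace_class_eq_iff\<close>)

section \<open>Continuity of the length parametrization on traces\<close>

lemma trace_length:
  obtains tlen where "continuous_map trace_subspace euclideanreal tlen"
    "\<And>x. x \<in> paths_in \<Longrightarrow> tlen (trace_class X x) = len x 1"
proof -
  have "continuous_map path_subspace (prod_topology path_subspace unit_interval) (\<lambda>x. (x, 1))"
    by (simp add: continuous_map_paired flip: id_def)
  from continuous_map_compose [OF this continuous_map_len]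
  have "continuous_map path_subspace euclideanreal (\<lambda>x. len x 1)" by (simp add: o_def)
  moreover have "len x 1 = len y 1"
    if "x \<in> topspace path_subspace" "y \<in> topspace path_subspace" "trace_class X x = trace_class X y" for x y
    using that trace_class_eq_iff_same_graph [of x y] by (simp add: same_graph_def)
  ultimately show thesis
    by (rule quotient_map_lift_exists [OF quotient_map_subspaces]) (use that in auto)
qed

text \<open>With unnormalized lengths the parameter interval varies with the path and shrinks to the
  point 0 at constant paths. This region replaces the product with a fixed interval.\<close>

definition graph_region :: "((real \<Rightarrow> 'a) \<times> real) set" where
  "graph_region = {(x, s). x \<in> paths_in \<and> 0 \<le> s \<and> s \<le> len x 1}"

text \<open>The map is closed: the image of a closed S is the projection, along the compact time
  interval, of the closed set of (x,s,t) with (x,t) in S and \<open>len x t = s\<close>.\<close>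

lemma quotient_map_graph:
  "quotient_map (prod_topology path_subspace unit_interval) (subtopology (prod_topology path_subspace euclideanreal) graph_region)
     (\<lambda>p. (fst p, len (fst p) (snd p)))"
proof (rule continuous_closed_imp_quotient_map)
  let ?Q = "\<lambda>p. (fst p, len (fst p) (snd p))"
  have top: "topspace (subtopology (prod_topology path_subspace euclideanreal) graph_region) = graph_region"
    by (auto simp: graph_region_def paths_in_def)
  show im: "?Q ` topspace (prod_topology path_subspace unit_interval) = topspace (subtopology (prod_topology path_subspace euclideanreal) graph_region)"
    unfolding top
  proof (intro equalityI subsetI)
    fix p assume "p \<in> graph_region"
    then obtain x s where p: "p = (x, s)" "x \<in> paths_in" "0 \<le> s" "s \<le> len x 1"
      by (auto simp: graph_region_def)
    then obtain t where "t \<in> {0..1}" "len x t = s" using len_surj by metis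
    then show "p \<in> ?Q ` topspace (prod_topology path_subspace unit_interval)"
      using p paths_in_subset by (force simp: image_iff)
  qed (use len_range in \<open>auto simp: graph_region_def\<close>)
  show "continuous_map (prod_topology path_subspace unit_interval) (subtopology (prod_topology path_subspace euclideanreal) graph_region) ?Q"
    by (intro continuous_map_into_subtopology continuous_map_pairedI continuous_map_fst continuous_map_len)
      (use im top in auto)
  show "closed_map (prod_topology path_subspace unit_interval) (subtopology (prod_topology path_subspace euclideanreal) graph_region) ?Q"
  proof (rule closed_map_into_subtopology)
    show "?Q \<in> topspace (prod_topology path_subspace unit_interval) \<rightarrow> graph_region"
      using im top by blast
    show "closed_map (prod_topology path_subspace unit_interval) (prod_topology path_subspace euclideanreal) ?Q"
      unfolding closed_map_def
    proof (intro allI impI)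
      fix S assume S: "closedin (prod_topology path_subspace unit_interval) S"
      let ?Z = "prod_topology (prod_topology path_subspace euclideanreal) unit_interval"
      have drop: "continuous_map ?Z (prod_topology path_subspace unit_interval) (\<lambda>q. (fst (fst q), snd q))"
        by (intro continuous_map_pairedI continuous_map_snd
            continuous_map_compose [OF continuous_map_fst continuous_map_fst, unfolded o_def])
      have "continuous_map ?Z euclideanreal (\<lambda>q. len (fst (fst q)) (snd q) - snd (fst q))"
        using continuous_map_compose [OF drop continuous_map_len]
        by (intro continuous_map_diff continuous_map_compose [OF continuous_map_fst continuous_map_snd, unfolded o_def])
          (simp add: o_def)
      then have "closedin ?Z {q \<in> topspace ?Z. len (fst (fst q)) (snd q) - snd (fst q) \<in> {0}}"
        by (rule closedin_continuous_map_preimage) simp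
      moreover have "closedin ?Z {q \<in> topspace ?Z. (fst (fst q), snd q) \<in> S}"
        by (rule closedin_continuous_map_preimage [OF drop S])
      ultimately have W: "closedin ?Z ({q \<in> topspace ?Z. (fst (fst q), snd q) \<in> S} \<inter>
          {q \<in> topspace ?Z. len (fst (fst q)) (snd q) - snd (fst q) \<in> {0}})"
        by blast
      have fst: "closed_map ?Z (prod_topology path_subspace euclideanreal) fst"
        by (rule closed_map_fst) (simp add: compact_space_subtopology)
      have "?Q ` S = fst ` ({q \<in> topspace ?Z. (fst (fst q), snd q) \<in> S} \<inter>
          {q \<in> topspace ?Z. len (fst (fst q)) (snd q) - snd (fst q) \<in> {0}})"
        using closedin_subset [OF S] by (force simp: image_iff)
      then show "closedin (prod_topology path_subspace euclideanreal) (?Q ` S)"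
        using fst [unfolded closed_map_def, rule_format, OF W] by (simp only:)
    qed
  qed
qed

text \<open>\<open>L\<close> is the \<open>\<mu>\<close>-length parametrization of a trace.\<close>

lemma trace_length_parametrization:
  assumes tlen: "continuous_map trace_subspace euclideanreal tlen"
      "\<And>x. x \<in> paths_in \<Longrightarrow> tlen (trace_class X x) = len x 1"
  obtains L where
    "continuous_map (subtopology (prod_topology trace_subspace euclideanreal) {(\<tau>, s). 0 \<le> s \<and> s \<le> tlen \<tau>}) (underlying X) L"
    "\<And>x t. \<lbrakk>x \<in> paths_in; t \<in> {0..1}\<rbrakk> \<Longrightarrow> L (trace_class X x, len x t) = x t"
proof -
  let ?E = "{(\<tau>, s). 0 \<le> s \<and> s \<le> tlen \<tau>}"
  let ?q = "\<lambda>p. (trace_class X (fst p), len (fst p) (snd p))"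
  let ?TR = "prod_topology trace_subspace euclideanreal"
  have cl: "closedin ?TR (topspace ?TR \<inter> ?E)"
  proof -
    have "continuous_map ?TR euclideanreal (\<lambda>p. tlen (fst p) - snd p)"
      by (intro continuous_map_diff continuous_map_snd continuous_map_compose [OF continuous_map_fst tlen(1), unfolded o_def])
    then have "closedin ?TR {p \<in> topspace ?TR. tlen (fst p) - snd p \<in> {0..}}"
      by (rule closedin_continuous_map_preimage) simp
    moreover have "closedin ?TR {p \<in> topspace ?TR. snd p \<in> {0..}}"
      by (rule closedin_continuous_map_preimage [OF continuous_map_snd]) simp
    ultimately have "closedin ?TR ({p \<in> topspace ?TR. snd p \<in> {0..}} \<inter> {p \<in> topspace ?TR. tlen (fst p) - snd p \<in> {0..}})"
      by blast
    moreover have "{p \<in> topspace ?TR. snd p \<in> {0..}} \<inter> {p \<in> topspace ?TR. tlen (fst p) - snd p \<in> {0..}}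
        = topspace ?TR \<inter> ?E" by auto
    ultimately show ?thesis by simp
  qed
  \<comment> \<open>Local compactness of the line makes this product a quotient map; closedness of
    the region below the graph of \<open>tlen\<close> then allows restriction to it.\<close>
  have "quotient_map (prod_topology path_subspace euclideanreal) ?TR (\<lambda>(x, s). (trace_class X x, s))"
    by (rule quotient_map_prod_left [OF locally_compact_space_euclidean _ quotient_map_subspaces]) simp
  then have "quotient_map (subtopology (prod_topology path_subspace euclideanreal) graph_region) (subtopology ?TR (topspace ?TR \<inter> ?E))
      (\<lambda>(x, s). (trace_class X x, s))"
    by (rule quotient_map_restriction) (use cl tlen(2) paths_in_subset in \<open>auto simp: graph_region_def\<close>)
  then have "quotient_map (subtopology (prod_topology path_subspace euclideanreal) graph_region) (subtopology ?TR ?E)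
      (\<lambda>(x, s). (trace_class X x, s))"
    by (simp only: subtopology_restrict)
  from quotient_map_compose [OF quotient_map_graph this]
  have q: "quotient_map (prod_topology path_subspace unit_interval) (subtopology ?TR ?E) ?q"
    by (simp add: o_def)
  have ev: "continuous_map (prod_topology path_subspace unit_interval) (underlying X) (\<lambda>p. fst p (snd p))"
    using continuous_map_path_subspace_eval unfolding metric [symmetric]
    by (rule continuous_map_into_fulltopology)
  have agree: "fst p (snd p) = fst p' (snd p')"
    if "p \<in> topspace (prod_topology path_subspace unit_interval)" "p' \<in> topspace (prod_topology path_subspace unit_interval)" "?q p = ?q p'" for p p'
    using that trace_class_eq_iff_same_graph [of "fst p" "fst p'"] by (auto simp: same_graph_def)
  show thesis
  proof (rule quotient_map_lift_exists [OF q ev])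
    show "fst p (snd p) = fst p' (snd p')"
      if "p \<in> topspace (prod_topology path_subspace unit_interval)"
        "p' \<in> topspace (prod_topology path_subspace unit_interval)" "?q p = ?q p'" for p p'
      using that by (rule agree)
    fix L assume L: "continuous_map (subtopology ?TR ?E) (underlying X) L"
      "\<And>p. p \<in> topspace (prod_topology path_subspace unit_interval) \<Longrightarrow> L (?q p) = fst p (snd p)"
    show thesis
      by (rule that [OF L(1)]) (use L(2) [of "(x, t)" for x t] in auto)
  qed
qed

text \<open>Distinct traces differ in total length or in the point reached at some length, so
  \<open>tlen\<close> or evaluation of \<open>L\<close> at that length separates them.\<close>

lemma Hausdorff_space_traces_in: "Hausdorff_space trace_subspace"
  unfolding Hausdorff_space_def
proof (intro allI impI, elim conjE)
  fix \<sigma> \<tau> assume \<sigma>: "\<sigma> \<in> topspace trace_subspace" and \<tau>: "\<tau> \<in> topspace trace_subspace" and ne: "\<sigma> \<noteq> \<tau>"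
  obtain tlen where tlen: "continuous_map trace_subspace euclideanreal tlen"
      "\<And>x. x \<in> paths_in \<Longrightarrow> tlen (trace_class X x) = len x 1"
    using trace_length by blast
  obtain L where L: "continuous_map (subtopology (prod_topology trace_subspace euclideanreal) {(\<tau>, s). 0 \<le> s \<and> s \<le> tlen \<tau>}) (underlying X) L"
    "\<And>x t. \<lbrakk>x \<in> paths_in; t \<in> {0..1}\<rbrakk> \<Longrightarrow> L (trace_class X x, len x t) = x t"
    using trace_length_parametrization [OF tlen] by blast
  obtain x y where xy: "x \<in> paths_in" "\<sigma> = trace_class X x" "y \<in> paths_in" "\<tau> = trace_class X y"
    using \<sigma> \<tau> by auto
  show "\<exists>U V. openin trace_subspace U \<and> openin trace_subspace V \<and> \<sigma> \<in> U \<and> \<tau> \<in> V \<and> disjnt U V"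
  proof (cases "len x 1 = len y 1")
    case False
    then show ?thesis using separated_by_continuous_map [OF tlen(1) _ \<sigma> \<tau>] xy tlen(2) by simp
  next
    case True
    then obtain s t where st: "s \<in> {0..1}" "t \<in> {0..1}" "len x s = len y t" "x s \<noteq> y t"
      using ne trace_class_eq_iff_same_graph [of x y] xy unfolding same_graph_def by blast
    have nonneg: "0 \<le> tlen \<tau>" if "\<tau> \<in> topspace trace_subspace" for \<tau>
      using that tlen(2) len_range(1) [of _ 1] by auto
    \<comment> \<open>Capping at \<open>tlen\<close> keeps the length admissible for every trace; at
      \<sigma> and \<tau> the cap is inactive.\<close>
    have "continuous_map trace_subspace (subtopology (prod_topology trace_subspace euclideanreal) {(\<tau>, s). 0 \<le> s \<and> s \<le> tlen \<tau>})
        (\<lambda>\<tau>. (\<tau>, min (len x s) (tlen \<tau>)))"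
      by (intro continuous_map_into_subtopology continuous_map_pairedI continuous_map_real_min tlen(1))
        (use nonneg len_range(1) [OF xy(1) st(1)] in \<open>auto simp flip: id_def\<close>)
    from continuous_map_compose [OF this L(1)]
    have ev: "continuous_map trace_subspace (underlying X) (\<lambda>\<tau>. L (\<tau>, min (len x s) (tlen \<tau>)))" by (simp add: o_def)
    have "L (\<sigma>, min (len x s) (tlen \<sigma>)) = x s"
      using L(2) [OF xy(1) st(1)] tlen(2) [OF xy(1)] xy(2) len_range(2) [OF xy(1) st(1)] by simp
    moreover have "L (\<tau>, min (len x s) (tlen \<tau>)) = y t"
      using L(2) [OF xy(3) st(2)] tlen(2) [OF xy(3)] xy(4) len_range(2) [OF xy(3) st(2)] st(3) by simp
    ultimately show ?thesis using separated_by_continuous_map [OF ev haus \<sigma> \<tau>] st(4) by simp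
  qed
qed

section \<open>Lifting discs of traces\<close>

lemma continuous_map_into_trace_subspace:
  assumes "continuous_map B (trace_space X u v) h"
    and "\<And>b x. \<lbrakk>b \<in> topspace B; x \<in> dpaths_between X u v; trace_class X x = h b\<rbrakk> \<Longrightarrow> x ` {0..1} \<subseteq> K"
  shows "continuous_map B trace_subspace h"
  unfolding trace_subspace_def
proof (rule continuous_map_into_subtopology [OF assms(1)], rule)
  fix b assume b: "b \<in> topspace B"
  then obtain x where "x \<in> dpaths_between X u v" "h b = trace_class X x"
    using continuous_map_image_subset_topspace [OF assms(1)] by (auto simp: topspace_trace_space)
  with assms(2) [OF b] show "h b \<in> trace_class X ` paths_in"
    by (auto simp: paths_in_def)
qed

text \<open>The lift must equal \<open>g\<close> on the sphere as a path, not merely as a trace. The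
  length function of \<open>g a\<close> retains exactly the timing that the trace forgets: following
  \<open>L\<close> with it returns \<open>g a\<close>.\<close>

lemma disc_lift:
  assumes h: "continuous_map (disc n) trace_subspace h"
    and g: "continuous_map (bsphere n) (path_space X u v) g"
    and gh: "\<And>a. a \<in> topspace (bsphere n) \<Longrightarrow> trace_class X (g a) = h a"
  shows "\<exists>l. continuous_map (disc n) (path_space X u v) l \<and>
    (\<forall>a\<in>topspace (bsphere n). l a = g a) \<and> (\<forall>b\<in>topspace (disc n). trace_class X (l b) = h b)"
proof -
  let ?D = "disc n" and ?DI = "prod_topology (disc n) unit_interval"
  obtain tlen where tlen: "continuous_map trace_subspace euclideanreal tlen"
      "\<And>x. x \<in> paths_in \<Longrightarrow> tlen (trace_class X x) = len x 1"
    using trace_length by blast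
  let ?E = "{(\<tau>, s). 0 \<le> s \<and> s \<le> tlen \<tau>}"
  obtain L where L: "continuous_map (subtopology (prod_topology trace_subspace euclideanreal) ?E) (underlying X) L"
    "\<And>x t. \<lbrakk>x \<in> paths_in; t \<in> {0..1}\<rbrakk> \<Longrightarrow> L (trace_class X x, len x t) = x t"
    using trace_length_parametrization [OF tlen] by blast
  have rep: "\<exists>x\<in>paths_in. h b = trace_class X x" if "b \<in> topspace ?D" for b
    using continuous_map_image_subset_topspace [OF h] that by auto
  have sphere_disc: "a \<in> topspace ?D" if "a \<in> topspace (bsphere n)" for a
    using that by (auto simp: topspace_disc topspace_bsphere)
  have g_in: "g a \<in> paths_in" if a: "a \<in> topspace (bsphere n)" for a
  proof -
    have "g a \<in> topspace (path_space X u v)" using g a by (auto simp: continuous_map_def)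
    moreover have "trace_class X (g a) \<in> trace_class X ` paths_in"
      using gh [OF a] rep [OF sphere_disc [OF a]] by auto
    ultimately show ?thesis using trace_class_preimage by blast
  qed
  then have g': "continuous_map (bsphere n) path_subspace g"
    unfolding path_subspace_def using g by (auto intro: continuous_map_into_subtopology)

  \<comment> \<open>\<open>w\<close> is the radial extension of the length function of \<open>g\<close>. The correction added in \<open>N\<close> vanishes
    on the sphere and ensures that the full length of \<open>h b\<close> is reached at time \<open>1\<close>.\<close>
  define r where "r b = sqrt (\<Sum>i<n. b i ^ 2)" for b :: "nat \<Rightarrow> real"
  \<comment> \<open>At the centre, the only point if n = 0, division by zero makes this the zero
    vector, which is not on the sphere; in \<open>w\<close> the value of \<open>g\<close> there is
    multiplied by radius 0.\<close>
  define dirn where "dirn b i = b i / r b" for b i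
  define w where "w p = r (fst p) * len (g (dirn (fst p))) (snd p)" for p
  define N where "N p = min (w p + snd p * \<bar>tlen (h (fst p)) - w (fst p, 1)\<bar>) (tlen (h (fst p)))" for p
  define F where "F p = L (h (fst p), N p)" for p
  define l where "l b = (\<lambda>t\<in>{0..1}. F (b, t))" for b

  have r0: "0 \<le> r b" for b by (simp add: r_def sum_nonneg)
  have r: "continuous_map ?D euclideanreal r"
    unfolding r_def by (intro continuous_intros continuous_map_disc_coord) auto
  have dirn_sphere: "dirn b \<in> topspace (bsphere n)" if "b \<in> topspace ?D" "r b \<noteq> 0" for b
  proof -
    have "(\<Sum>i<n. dirn b i ^ 2) = (\<Sum>i<n. b i ^ 2) / (r b)\<^sup>2"
      by (simp add: dirn_def power_divide sum_divide_distrib)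
    also have "\<dots> = 1" using that(2) by (simp add: r_def sum_nonneg)
    finally show ?thesis using that(1) by (auto simp: topspace_bsphere topspace_disc dirn_def)
  qed
  have w: "continuous_map ?DI euclideanreal w"
  proof (rule continuous_map_real_bounded_vanishing)
    show r1: "continuous_map ?DI euclideanreal (\<lambda>p. r (fst p))"
      using continuous_map_compose [OF continuous_map_fst r] by (simp add: o_def)
    let ?S = "subtopology ?DI {p. r (fst p) \<noteq> 0}"
    have "continuous_map ?S (bsphere n) (\<lambda>p. dirn (fst p))"
    proof (rule continuous_map_into_bsphere)
      fix i
      have "continuous_map ?DI euclideanreal (\<lambda>p. fst p i)"
        using continuous_map_compose [OF continuous_map_fst continuous_map_disc_coord] by (simp add: o_def)
      then show "continuous_map ?S euclideanreal (\<lambda>p. dirn (fst p) i)"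
        unfolding dirn_def
        by (intro continuous_map_real_divide continuous_map_from_subtopology r1) auto
    qed (use dirn_sphere in auto)
    from continuous_map_compose [OF this g']
    have "continuous_map ?S (prod_topology path_subspace unit_interval) (\<lambda>p. (g (dirn (fst p)), snd p))"
      by (intro continuous_map_pairedI continuous_map_from_subtopology [OF continuous_map_snd]) (simp add: o_def)
    from continuous_map_compose [OF this continuous_map_len]
    show "continuous_map ?S euclideanreal w"
      unfolding w_def
      by (intro continuous_map_real_mult continuous_map_from_subtopology [OF r1]) (simp add: o_def)
    \<comment> \<open>Here the bound 1 on \<mu>-length, uniform over all paths, yields continuity at
      the centre.\<close>
    show "\<bar>w p\<bar> \<le> \<bar>r (fst p)\<bar>" if p: "p \<in> topspace ?DI" for p
    proof (cases "r (fst p) = 0")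
      case False
      then have "g (dirn (fst p)) \<in> paths_in" using p dirn_sphere g_in by auto
      then have "0 \<le> len (g (dirn (fst p))) (snd p)" "len (g (dirn (fst p))) (snd p) \<le> 1"
        using p len_range by auto
      then show ?thesis using r0 [of "fst p"] by (simp add: w_def abs_mult mult_left_le)
    qed (simp add: w_def)
  qed
  have w_0: "w (b, 0) = 0" and w_mono: "\<lbrakk>0 \<le> s; s \<le> t; t \<le> 1\<rbrakk> \<Longrightarrow> w (b, s) \<le> w (b, t)"
    if b: "b \<in> topspace ?D" for b s t
  proof -
    have "r b = 0 \<or> g (dirn b) \<in> paths_in" using b dirn_sphere g_in by blast
    then show "w (b, 0) = 0" by (auto simp: w_def len_0)
    show "w (b, s) \<le> w (b, t)" if "0 \<le> s" "s \<le> t" "t \<le> 1"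
      using that r0 [of b] by (auto simp: w_def intro!: mult_left_mono mu_length_mono)
  qed
  have tlen_h: "continuous_map ?DI euclideanreal (\<lambda>p. tlen (h (fst p)))"
    using continuous_map_compose [OF continuous_map_fst continuous_map_compose [OF h tlen(1)]] by (simp add: o_def)
  have "continuous_map ?DI ?DI (\<lambda>p. (fst p, 1))"
    by (intro continuous_map_pairedI continuous_map_fst) auto
  from continuous_map_compose [OF this w]
  have N: "continuous_map ?DI euclideanreal N"
    unfolding N_def
    by (intro continuous_map_real_min continuous_map_add continuous_map_real_mult continuous_map_real_abs
        continuous_map_diff tlen_h w continuous_map_into_fulltopology [OF continuous_map_snd]) (simp add: o_def)
  have tlen_nonneg: "0 \<le> tlen (h b)" if "b \<in> topspace ?D" for b
    using rep [OF that] tlen(2) len_range(1) [of _ 1] by auto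
  have N_0: "N (b, 0) = 0" if "b \<in> topspace ?D" for b
    using tlen_nonneg [OF that] w_0 [OF that] by (simp add: N_def)
  \<comment> \<open>For every real w, \<open>w + \<bar>T - w\<bar> \<ge> T\<close>, so at time 1 the
    minimum is the total length T. At all times the minimum keeps \<open>N\<close> within the domain
    of \<open>L\<close>.\<close>
  have N_1: "N (b, 1) = tlen (h b)" for b
    by (simp add: N_def)
  have N_mono: "N (b, s) \<le> N (b, t)" if "b \<in> topspace ?D" "0 \<le> s" "s \<le> t" "t \<le> 1" for b s t
    using w_mono [OF that] mult_right_mono [OF that(3), of "\<bar>tlen (h b) - w (b, 1)\<bar>"]
    by (auto simp: N_def min_def)
  have F: "continuous_map ?DI (underlying X) F"
  proof -
    have "continuous_map ?DI (subtopology (prod_topology trace_subspace euclideanreal) ?E) (\<lambda>p. (h (fst p), N p))"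
    proof (intro continuous_map_into_subtopology continuous_map_pairedI N)
      show "continuous_map ?DI trace_subspace (\<lambda>p. h (fst p))"
        using continuous_map_compose [OF continuous_map_fst h] by (simp add: o_def)
      show "(\<lambda>p. (h (fst p), N p)) \<in> topspace ?DI \<rightarrow> ?E"
        using N_mono [of _ 0] N_mono [of _ _ 1] N_0 N_1 by fastforce
    qed
    from continuous_map_compose [OF this L(1)] show ?thesis by (simp add: F_def [abs_def] o_def)
  qed
  have l_equiv: "l b \<in> dpaths_between X u v \<and> trace_class X (l b) = h b" if b: "b \<in> topspace ?D" for b
  proof -
    obtain x where x: "x \<in> paths_in" "h b = trace_class X x" using rep [OF b] by blast
    have "trace_equiv X x (l b)"
    proof (rule trace_equiv_of_len_factor [OF x(1)])
      have "continuous_map unit_interval ?DI (\<lambda>t. (b, t))"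
        using b by (simp add: continuous_map_paired flip: id_def)
      from continuous_map_compose [OF this N] show "continuous_on {0..1} (\<lambda>t. N (b, t))"
        by (simp add: o_def)
      show "mono_on {0..1} (\<lambda>t. N (b, t))"
        by (intro mono_onI N_mono b) auto
      show "N (b, 0) = 0" "N (b, 1) = len x 1"
        using N_0 [OF b] N_1 [of b] tlen(2) [OF x(1)] x(2) by auto
      show "l b t' = x t" if "t \<in> {0..1}" "t' \<in> {0..1}" "len x t = N (b, t')" for t t'
        using that L(2) [OF x(1), of t] x(2) by (simp add: l_def F_def)
    qed (simp add: l_def)
    then show ?thesis
      using trace_equiv_dpaths_between(1) [of x "l b" u v] x paths_in_subset
      by (auto simp flip: trace_class_eq_iff)
  qed
  have "continuous_map ?D (subtopology (compact_open (underlying X)) (dpaths_between X u v)) l"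
    unfolding l_def
    by (rule continuous_map_into_subtopology [OF continuous_map_into_compact_open [OF F]])
      (use l_equiv in \<open>auto simp: l_def\<close>)
  \<comment> \<open>Passage to the \<Delta>-generated refinement is possible because the disc is a
    quotient of a simplex.\<close>
  then have "continuous_map ?D (path_space X u v) l"
    unfolding path_space_def
    using disc_quotient_of_simplex [of n] continuous_map_into_k_Delta by metis
  moreover have "l a = g a" if a: "a \<in> topspace (bsphere n)" for a
  proof (rule extensionalityI [OF _ paths_in_extensional [OF g_in [OF a]]])
    have "r a = 1" using a by (simp add: r_def topspace_bsphere)
    then have wa: "w (a, t) = len (g a) t" for t
      by (simp add: w_def dirn_def [abs_def])
    have ta: "tlen (h a) = len (g a) 1" using tlen(2) [OF g_in [OF a]] gh [OF a] by simp
    show "l a t = g a t" if t: "t \<in> {0..1}" for t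
      using L(2) [OF g_in [OF a] t] t gh [OF a] len_range(2) [OF g_in [OF a] t]
      by (simp add: l_def F_def N_def wa ta)
  qed (simp add: l_def)
  ultimately show ?thesis using l_equiv by blast
qed

end

section \<open>Reduction to a metrizable set for each interval or disc of traces\<close>

theorem theorem8p4:
  fixes C :: Top_choice and X :: "'a dspace" and u v :: 'a
  assumes "directed_space C X"
    and "saturated X"
    and "Hausdorff_space (underlying X)"
    and "\<And>K. compactin (underlying X) K \<Longrightarrow> metrizable_space (subtopology (underlying X) K)"
    and "u \<in> topspace (underlying X)"
    and "v \<in> topspace (underlying X)"
  shows "trivial_q_fibration C (path_space X u v) (trace_space X u v) (trace_class X) \<and>
         Delta_Hausdorff (trace_space X u v)"
proof -
  let ?P = "path_space X u v" and ?T = "trace_space X u v" and ?q = "trace_class X"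
  interpret directed C X by unfold_locales fact
  \<comment> \<open>Both K and its metric depend on B and h; this is applied to the interval for
    closedness of images and to discs for lifting.\<close>
  have local_metric: "\<exists>K d. metrizable_traces C X K d \<and>
      continuous_map B (metrizable_traces.trace_subspace X K u v) h"
    if B: "compact_space B" and h: "continuous_map B ?T h" for B :: "'b topology" and h
  proof -
    obtain K where K: "compactin (underlying X) K"
      "\<And>b x. \<lbrakk>b \<in> topspace B; x \<in> dpaths_between X u v; ?q x = h b\<rbrakk> \<Longrightarrow> x ` {0..1} \<subseteq> K"
      using compactin_union_of_traces [OF B h] by blast
    obtain M d where d: "Metric_space M d" "subtopology (underlying X) K = Metric_space.mtopology M d"
      using assms(4) [OF K(1)] by (auto simp: metrizable_space_def)
    have "M = topspace (subtopology (underlying X) K)"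
      using Metric_space.topspace_mtopology [OF d(1)] d(2) by simp
    then have "M = K" using compactin_subset_topspace [OF K(1)] by auto
    then interpret metrizable_traces C X K d u v
      using d compactin_imp_closedin [OF assms(3) K(1)] assms(2,3)
      by (intro metrizable_traces.intro metrizable_traces_axioms.intro directed_axioms) auto
    have "continuous_map B trace_subspace h"
      by (rule continuous_map_into_trace_subspace [OF h]) (rule K(2))
    then show ?thesis using metrizable_traces_axioms by blast
  qed
  have haus_P: "Hausdorff_space ?P"
    unfolding path_space_def
    by (intro Hausdorff_space_k_Delta Hausdorff_space_subtopology Hausdorff_space_compact_open assms(3))
  have haus_T: "Delta_Hausdorff ?T"
    unfolding Delta_Hausdorff_def
  proof (intro allI impI)
    fix f assume "pathin ?T f"
    then obtain K d where "metrizable_traces C X K d"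
      and f: "continuous_map unit_interval (metrizable_traces.trace_subspace X K u v) f"
      using local_metric [of unit_interval f] by (auto simp: pathin_def compact_space_subtopology)
    then interpret metrizable_traces C X K d u v by blast
    \<comment> \<open>A compact set is closed in the Hausdorff subspace of traces in K, and that
      subspace is closed in the trace space.\<close>
    have "compactin trace_subspace (f ` {0..1})"
      using f by (intro image_compactin [of unit_interval]) (auto simp: compactin_subtopology)
    then show "closedin ?T (f ` {0..1})"
      using compactin_imp_closedin [OF Hausdorff_space_traces_in] closedin_traces_in closedin_trans_full
      unfolding trace_subspace_def by blast
  qed
  have gen_P: "Delta_generated ?P"
    unfolding path_space_def by (rule Delta_generated_k_Delta)
  then have gen_T: "Delta_generated ?T"
    by (rule Delta_generated_quotient [OF _ quotient_map_trace_class])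
  have "has_rlp (bsphere n) (disc n) id ?P ?T ?q" for n
    unfolding has_rlp_def
  proof (intro allI impI, elim conjE)
    fix g h assume g: "continuous_map (bsphere n) ?P g" and h: "continuous_map (disc n) ?T h"
      and gh: "\<forall>a\<in>topspace (bsphere n). ?q (g a) = h (id a)"
    obtain K d where "metrizable_traces C X K d"
      and h': "continuous_map (disc n) (metrizable_traces.trace_subspace X K u v) h"
      using local_metric [OF compact_space_disc h] by blast
    then interpret metrizable_traces C X K d u v by blast
    show "\<exists>l. continuous_map (disc n) ?P l \<and> (\<forall>a\<in>topspace (bsphere n). l (id a) = g a) \<and>
        (\<forall>b\<in>topspace (disc n). ?q (l b) = h b)"
      using disc_lift [OF h' g] gh by simp
  qed
  then have "trivial_q_fibration C ?P ?T ?q"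
    unfolding trivial_q_fibration_def
    using gen_P gen_T haus_T Hausdorff_space_imp_Delta_Hausdorff [OF haus_P]
      quotient_imp_continuous_map [OF quotient_map_trace_class]
    by (cases C) auto
  with haus_T show ?thesis by blast
qed

end
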